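(* Every commutative quasi-thin scheme is schurian.
   Context: A coherent configuration is a pair $(\Omega,S)$ with $\Omega$ finite and $S$ a partition of $\Omega\times\Omega$ (basic relations) such that $1_\Omega$ is a union of elements of $S$, $S$ is closed under transposition, and for $u,v,w\in S$ the number $c_{uv}^w=|\alpha u\cap\gamma v^*|$ (with $\alpha r=\{\beta:(\alpha,\beta)\in r\}$) is independent of $(\alpha,\gamma)\in w$. It is a scheme if $1_\Omega\in S$, and commutative if $c_{uv}^w=c_{vu}^w$ for all $u,v,w\in S$. In a scheme the valency of $u$ is $|\alpha u|$ (independent of $\alpha$); a scheme is quasi-thin if every basic relation has valency $1$ or $2$. A coherent configuration is schurian if there is a permutation group $G\le\mathrm{Sym}(\Omega)$ whose orbits on $\Omega\times\Omega$ are exactly the basic relations. *)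

theory Defs
  imports "HOL-Algebra.Group_Action" "HOL-Library.Disjoint_Sets"
begin

text \<open>
  For a relation \<open>r\<close>, the neighbourhood of \<open>\<alpha>\<close> is the relational image \<open>r `` {\<alpha>}\<close>,
  and the transpose of \<open>r\<close> is its converse. The point set is an explicit carrier \<open>\<Omega>\<close>,
  so the diagonal is \<open>Id_on \<Omega>\<close>.
\<close>

locale coherent_configuration =
  fixes \<Omega> :: "'a set" and S :: "('a \<times> 'a) set set"
  assumes finite_points: "finite \<Omega>"
    and partition: "partition_on (\<Omega> \<times> \<Omega>) S"
    and diagonal_union: "\<exists>T \<subseteq> S. Id_on \<Omega> = \<Union>T"
    and converse_closed: "u \<in> S \<Longrightarrow> u\<inverse> \<in> S"
    and intersection_regular:
      "\<lbrakk>u \<in> S; v \<in> S; w \<in> S; (\<alpha>, \<gamma>) \<in> w; (\<alpha>', \<gamma>') \<in> w\<rbrakk> \<Longrightarrow>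
        card (u `` {\<alpha>} \<inter> v\<inverse> `` {\<gamma>}) = card (u `` {\<alpha>'} \<inter> v\<inverse> `` {\<gamma>'})"

definition intersection_number ::
    "('a \<times> 'a) set \<Rightarrow> ('a \<times> 'a) set \<Rightarrow> ('a \<times> 'a) set \<Rightarrow> nat" where
  "intersection_number u v w =
    (THE n. \<forall>(\<alpha>, \<gamma>) \<in> w. card (u `` {\<alpha>} \<inter> v\<inverse> `` {\<gamma>}) = n)"

definition commutative_configuration :: "('a \<times> 'a) set set \<Rightarrow> bool" where
  "commutative_configuration S \<longleftrightarrow>
    (\<forall>u\<in>S. \<forall>v\<in>S. \<forall>w\<in>S. intersection_number u v w = intersection_number v u w)"

text \<open>Blocks of a partition are nonempty, so the point set of a scheme is nonempty.\<close>

locale scheme = coherent_configuration +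
  assumes diagonal_basic: "Id_on \<Omega> \<in> S"

definition valency :: "'a set \<Rightarrow> ('a \<times> 'a) set \<Rightarrow> nat" where
  "valency \<Omega> u = (THE n. \<forall>\<alpha>\<in>\<Omega>. card (u `` {\<alpha>}) = n)"

definition quasi_thin :: "'a set \<Rightarrow> ('a \<times> 'a) set set \<Rightarrow> bool" where
  "quasi_thin \<Omega> S \<longleftrightarrow> (\<forall>u\<in>S. valency \<Omega> u = 1 \<or> valency \<Omega> u = 2)"

text \<open>
  \<open>BijGroup \<Omega>\<close> is the symmetric group on \<open>\<Omega>\<close>; its elements are extensional functions.
  The componentwise action on pairs is restricted to \<open>\<Omega> \<times> \<Omega>\<close>, so that it takes values in
  \<open>BijGroup (\<Omega> \<times> \<Omega>)\<close> as required by \<^locale>\<open>group_action\<close>.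
\<close>

definition pair_action :: "'a set \<Rightarrow> ('a \<Rightarrow> 'a) \<Rightarrow> 'a \<times> 'a \<Rightarrow> 'a \<times> 'a" where
  "pair_action \<Omega> g = restrict (map_prod g g) (\<Omega> \<times> \<Omega>)"

definition schurian :: "'a set \<Rightarrow> ('a \<times> 'a) set set \<Rightarrow> bool" where
  "schurian \<Omega> S \<longleftrightarrow>
    (\<exists>G. subgroup G (BijGroup \<Omega>) \<and>
         S = orbits (BijGroup \<Omega>\<lparr>carrier := G\<rparr>) (\<Omega> \<times> \<Omega>) (pair_action \<Omega>))"

text \<open>The definite descriptions above are well defined.\<close>

lemma (in coherent_configuration) intersection_number_eq:
  assumes "u \<in> S" "v \<in> S" "w \<in> S" "(\<alpha>, \<gamma>) \<in> w"
  shows "intersection_number u v w = card (u `` {\<alpha>} \<inter> v\<inverse> `` {\<gamma>})"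
  unfolding intersection_number_def
proof (rule the_equality)
  show "\<forall>(\<alpha>', \<gamma>') \<in> w. card (u `` {\<alpha>'} \<inter> v\<inverse> `` {\<gamma>'}) = card (u `` {\<alpha>} \<inter> v\<inverse> `` {\<gamma>})"
    using intersection_regular[OF assms(1-3) _ assms(4)] by blast
qed (use assms(4) in auto)

lemma (in scheme) valency_eq:
  assumes "u \<in> S" "\<alpha> \<in> \<Omega>"
  shows "valency \<Omega> u = card (u `` {\<alpha>})"
  unfolding valency_def
proof (rule the_equality)
  have "card (u `` {\<beta>}) = card (u `` {\<alpha>})" if "\<beta> \<in> \<Omega>" for \<beta>
    using intersection_regular[OF assms(1) converse_closed[OF assms(1)] diagonal_basic,
        of \<beta> \<beta> \<alpha> \<alpha>] that assms(2) by (simp add: Id_onI)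
  then show "\<forall>\<beta>\<in>\<Omega>. card (u `` {\<beta>}) = card (u `` {\<alpha>})" by blast
qed (use assms(2) in auto)

lemma pair_action_group_action:
  assumes "subgroup G (BijGroup \<Omega>)"
  shows "group_action (BijGroup \<Omega>\<lparr>carrier := G\<rparr>) (\<Omega> \<times> \<Omega>) (pair_action \<Omega>)"
proof -
  have G: "G \<subseteq> Bij \<Omega>"
    using subgroup.subset[OF assms] by (simp add: BijGroup_def)
  have bij: "pair_action \<Omega> g \<in> Bij (\<Omega> \<times> \<Omega>)" if "g \<in> G" for g
  proof -
    have "bij_betw g \<Omega> \<Omega>" using that G by (auto simp: Bij_def)
    then have "bij_betw (map_prod g g) (\<Omega> \<times> \<Omega>) (\<Omega> \<times> \<Omega>)"
      by (rule bij_betw_map_prod) fact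
    then show ?thesis by (simp add: Bij_def pair_action_def)
  qed
  have mult: "pair_action \<Omega> (compose \<Omega> g h) =
      compose (\<Omega> \<times> \<Omega>) (pair_action \<Omega> g) (pair_action \<Omega> h)" if "g \<in> G" "h \<in> G" for g h
  proof -
    have "h x \<in> \<Omega>" if "x \<in> \<Omega>" for x
      using that \<open>h \<in> G\<close> G Bij_imp_funcset by blast
    then show ?thesis by (auto simp: fun_eq_iff pair_action_def compose_def restrict_def)
  qed
  have "pair_action \<Omega> \<in> hom (BijGroup \<Omega>\<lparr>carrier := G\<rparr>) (BijGroup (\<Omega> \<times> \<Omega>))"
    using G bij by (auto simp: hom_def BijGroup_def mult subset_iff)
  then show ?thesis
    by (intro group_action.intro group_hom.intro group_hom_axioms.intro group_BijGroup
        group.subgroup_imp_group assms)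
qed

end

theory Submission
  imports Defs
begin

text \<open>
  Write \<open>perp u\<close> for the basic relation joining the two \<open>u\<close>-neighbours of a point, for \<open>u\<close> of
  valency 2. Between two neighbourhoods of size 2 of a point \<open>a\<close> the scheme induces either a single
  relation or two perfect matchings, so exchanging the points of all these neighbourhoods at once is
  an automorphism fixing \<open>a\<close>. It remains to see that the automorphism group is transitive.

  Let \<open>(a, b) \<in> s\<close>. If \<open>s\<close> is thin, translation by \<open>s\<close> is an automorphism by commutativity. If some
  product \<open>u\<inverse> O v\<close> of nonthin relations is a single basic relation, then there is only one
  \<open>perp u\<close>, and an automorphism can be chosen freely on each orbit of the group of thin relations.
  Otherwise every point \<open>x\<close> is determined by the relations of \<open>a\<close> and \<open>b\<close> to \<open>x\<close>, and transporting
  these two relations to a pair \<open>(b, c) \<in> s\<close> defines the map. It fails to be an automorphism only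
  if two quadruples of points agree on five of their six relations and differ in the sixth. Comparing
  \<open>perp\<close> of the six relations forces the three occurring values of \<open>perp\<close> to be thin involutions,
  and a computation with thin relations then shows that the sixth relations agree as well.
\<close>

locale commutative_quasi_thin_scheme = scheme +
  assumes commutative: "commutative_configuration S"
    and quasi_thin: "quasi_thin \<Omega> S"
begin

section \<open>Basic relations, unions of basic relations, and their composition\<close>

definition thin :: "('a \<times> 'a) set \<Rightarrow> bool" where
  "thin t \<longleftrightarrow> t \<in> S \<and> single_valued t"

text \<open>In a quasi-thin scheme this is valency 2. Phrasing both valencies by
  \<open>single_valued\<close> keeps cardinalities out of the later arguments.\<close>

definition nonthin :: "('a \<times> 'a) set \<Rightarrow> bool" where
  "nonthin u \<longleftrightarrow> u \<in> S \<and> \<not> single_valued u"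

text \<open>These are the unions of basic relations. The class is closed under composition and
  converse, so products that are not basic can be handled in it.\<close>

definition saturated :: "('a \<times> 'a) set \<Rightarrow> bool" where
  "saturated R \<longleftrightarrow> R \<subseteq> \<Omega> \<times> \<Omega> \<and> (\<forall>u\<in>S. u \<inter> R \<noteq> {} \<longrightarrow> u \<subseteq> R)"

definition perp :: "('a \<times> 'a) set \<Rightarrow> ('a \<times> 'a) set" where
  "perp u = u\<inverse> O u - Id"

lemma basic_ex:
  assumes "x \<in> \<Omega>" "y \<in> \<Omega>"
  obtains u where "u \<in> S" "(x, y) \<in> u"
  using assms partition unfolding partition_on_def by blast

lemma basic_subset: "u \<in> S \<Longrightarrow> u \<subseteq> \<Omega> \<times> \<Omega>"
  using partition unfolding partition_on_def by blast

lemma basic_dom: "u \<in> S \<Longrightarrow> (x, y) \<in> u \<Longrightarrow> x \<in> \<Omega> \<and> y \<in> \<Omega>"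
  using basic_subset by blast

lemma basic_eq:
  assumes "u \<in> S" "v \<in> S" "(x, y) \<in> u" "(x, y) \<in> v"
  shows "u = v"
  using assms partition unfolding partition_on_def disjoint_def by blast

lemma basic_nonempty:
  assumes "u \<in> S"
  obtains x y where "(x, y) \<in> u"
proof -
  have "u \<noteq> {}" using assms partition unfolding partition_on_def by blast
  then show ?thesis using that by auto
qed

lemma basic_subset_eq:
  assumes "u \<in> S" "v \<in> S" "u \<subseteq> v"
  shows "u = v"
proof -
  obtain x y where "(x, y) \<in> u" using basic_nonempty[OF assms(1)] by metis
  then show ?thesis using basic_eq[OF assms(1,2)] assms(3) by (metis subsetD)
qed

lemma finite_image: "u \<in> S \<Longrightarrow> finite (u `` {x})"
  using basic_subset[of u] finite_subset[OF _ finite_points, of "u `` {x}"] by blast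

text \<open>The point \<open>y\<close> shows that an intersection number is nonzero at
  \<open>(x, z)\<close>; it is then nonzero at every pair of \<open>w\<close>.\<close>

lemma comp_transfer:
  assumes "u \<in> S" "v \<in> S" "w \<in> S" "(x, y) \<in> u" "(y, z) \<in> v" "(x, z) \<in> w"
  shows "w \<subseteq> u O v"
proof (rule subrelI)
  fix a c assume "(a, c) \<in> w"
  then have "card (u `` {a} \<inter> v\<inverse> `` {c}) = card (u `` {x} \<inter> v\<inverse> `` {z})"
    using intersection_regular assms by blast
  moreover have "finite (u `` {x} \<inter> v\<inverse> `` {z})" "y \<in> u `` {x} \<inter> v\<inverse> `` {z}"
    using finite_image assms by auto
  ultimately have "card (u `` {a} \<inter> v\<inverse> `` {c}) \<noteq> 0" by (metis card_eq_0_iff empty_iff)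
  then have "u `` {a} \<inter> v\<inverse> `` {c} \<noteq> {}" by force
  then show "(a, c) \<in> u O v" by blast
qed

text \<open>Nonzero intersection numbers detect composition, so commutativity of the scheme becomes
  commutativity of \<open>O\<close>, the form used from here on.\<close>

lemma basic_commute_sub:
  assumes "u \<in> S" "v \<in> S"
  shows "u O v \<subseteq> v O u"
proof (rule subrelI)
  fix x z assume "(x, z) \<in> u O v"
  then obtain y where y: "(x, y) \<in> u" "(y, z) \<in> v" by blast
  then obtain w where w: "w \<in> S" "(x, z) \<in> w" using basic_ex basic_dom assms by metis
  have "card (u `` {x} \<inter> v\<inverse> `` {z}) = card (v `` {x} \<inter> u\<inverse> `` {z})"
    using commutative assms w intersection_number_eq
    unfolding commutative_configuration_def by metis
  moreover have "finite (u `` {x} \<inter> v\<inverse> `` {z})" "y \<in> u `` {x} \<inter> v\<inverse> `` {z}"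
    using finite_image assms y by auto
  ultimately have "card (v `` {x} \<inter> u\<inverse> `` {z}) \<noteq> 0" by (metis card_eq_0_iff empty_iff)
  then have "v `` {x} \<inter> u\<inverse> `` {z} \<noteq> {}" by force
  then show "(x, z) \<in> v O u" by blast
qed

lemma saturatedD: "saturated R \<Longrightarrow> u \<in> S \<Longrightarrow> (x, y) \<in> u \<Longrightarrow> (x, y) \<in> R \<Longrightarrow> u \<subseteq> R"
  unfolding saturated_def by blast

lemma saturated_ex:
  assumes "saturated R" "(x, y) \<in> R"
  obtains u where "u \<in> S" "(x, y) \<in> u" "u \<subseteq> R"
proof -
  have "x \<in> \<Omega>" "y \<in> \<Omega>" using assms unfolding saturated_def by auto
  then obtain u where u: "u \<in> S" "(x, y) \<in> u" using basic_ex by metis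
  show ?thesis using that[OF u saturatedD[OF assms(1) u assms(2)]] .
qed

lemma saturated_basic:
  assumes "u \<in> S"
  shows "saturated u"
  unfolding saturated_def
proof (intro conjI ballI impI)
  show "u \<subseteq> \<Omega> \<times> \<Omega>" using basic_subset assms .
  fix v assume v: "v \<in> S" "v \<inter> u \<noteq> {}"
  then obtain x y where "(x, y) \<in> v" "(x, y) \<in> u" by auto
  then have "v = u" by (rule basic_eq[OF v(1) assms])
  then show "v \<subseteq> u" by simp
qed

lemma saturated_comp:
  assumes "saturated R" "saturated Q"
  shows "saturated (R O Q)"
  unfolding saturated_def
proof (intro conjI ballI impI)
  show "R O Q \<subseteq> \<Omega> \<times> \<Omega>" using assms unfolding saturated_def by blast
  fix u assume u: "u \<in> S" "u \<inter> (R O Q) \<noteq> {}"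
  then obtain x y z where xyz: "(x, z) \<in> u" "(x, y) \<in> R" "(y, z) \<in> Q" by blast
  then obtain a b where "a \<in> S" "(x, y) \<in> a" "a \<subseteq> R" "b \<in> S" "(y, z) \<in> b" "b \<subseteq> Q"
    using saturated_ex assms by metis
  then show "u \<subseteq> R O Q" using comp_transfer u xyz by blast
qed

lemma saturated_commute_sub:
  assumes "saturated R" "saturated Q"
  shows "R O Q \<subseteq> Q O R"
proof (rule subrelI)
  fix x z assume "(x, z) \<in> R O Q"
  then obtain y where xyz: "(x, y) \<in> R" "(y, z) \<in> Q" by blast
  then obtain a b where "a \<in> S" "(x, y) \<in> a" "a \<subseteq> R" "b \<in> S" "(y, z) \<in> b" "b \<subseteq> Q"
    using saturated_ex assms by metis
  then show "(x, z) \<in> Q O R" using basic_commute_sub[of a b] by blast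
qed

lemma saturated_commute: "saturated R \<Longrightarrow> saturated Q \<Longrightarrow> R O Q = Q O R"
  by (simp add: saturated_commute_sub subset_antisym)

text \<open>With associativity and \<open>saturated_commute\<close> this lets the simplifier sort
  long products of saturated relations.\<close>

lemma saturated_left_commute:
  "saturated R \<Longrightarrow> saturated Q \<Longrightarrow> R O (Q O P) = Q O (R O P)"
  by (metis O_assoc saturated_commute)

lemma saturated_converse:
  assumes "saturated R"
  shows "saturated (R\<inverse>)"
  unfolding saturated_def
proof (intro conjI ballI impI)
  show "R\<inverse> \<subseteq> \<Omega> \<times> \<Omega>" using assms unfolding saturated_def by blast
  fix v assume v: "v \<in> S" "v \<inter> R\<inverse> \<noteq> {}"
  then have "v\<inverse> \<inter> R \<noteq> {}" by auto
  then have "v\<inverse> \<subseteq> R" using assms converse_closed[OF v(1)] unfolding saturated_def by metis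
  then show "v \<subseteq> R\<inverse>" by auto
qed

lemma diagonal_comp: "saturated R \<Longrightarrow> Id_on \<Omega> O R = R"
  "saturated R \<Longrightarrow> R O Id_on \<Omega> = R"
  unfolding saturated_def by auto

section \<open>Valencies and neighbourhoods with at most two points\<close>

lemma basic_commute: "u \<in> S \<Longrightarrow> v \<in> S \<Longrightarrow> u O v = v O u"
  by (simp add: saturated_commute saturated_basic)

lemma card_image:
  assumes "u \<in> S" "x \<in> \<Omega>"
  shows "card (u `` {x}) = 1 \<or> card (u `` {x}) = 2"
  using assms quasi_thin valency_eq unfolding quasi_thin_def by metis

lemma basic_total:
  assumes "u \<in> S" "x \<in> \<Omega>"
  obtains y where "(x, y) \<in> u"
proof -
  have "u `` {x} \<noteq> {}" using card_image[OF assms] by force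
  then show ?thesis using that by blast
qed

lemma nonthin_basic: "nonthin u \<Longrightarrow> u \<in> S" and thin_basic: "thin u \<Longrightarrow> u \<in> S"
  unfolding nonthin_def thin_def by auto

lemma nonthin_image:
  assumes "nonthin u" "x \<in> \<Omega>"
  obtains a b where "a \<noteq> b" "u `` {x} = {a, b}"
proof -
  obtain y a b where "(y, a) \<in> u" "(y, b) \<in> u" "a \<noteq> b"
    using assms unfolding nonthin_def single_valued_def by blast
  moreover have u: "u \<in> S" using assms nonthin_basic by blast
  ultimately have "y \<in> \<Omega>" "a \<in> u `` {y}" "b \<in> u `` {y}" using basic_dom by auto
  moreover from this have "card (u `` {y}) \<noteq> 1"
    using \<open>a \<noteq> b\<close> by (metis card_1_singletonE singletonD)
  ultimately have "card (u `` {y}) = 2" using card_image u by blast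
  then have "card (u `` {x}) = 2"
    using valency_eq[OF u] assms(2) \<open>y \<in> \<Omega>\<close> by metis
  then show ?thesis using that by (auto simp: card_2_iff)
qed

lemma nonthin_other:
  assumes "nonthin u" "(x, y) \<in> u"
  obtains y' where "y' \<noteq> y" "(x, y') \<in> u"
proof -
  have "x \<in> \<Omega>" using assms basic_dom nonthin_basic by blast
  then obtain a b where ab: "a \<noteq> b" "u `` {x} = {a, b}" using nonthin_image assms by metis
  then have "(x, a) \<in> u" "(x, b) \<in> u" by auto
  then show ?thesis using that ab by metis
qed

lemma image_two:
  assumes "u \<in> S" "(x, a) \<in> u" "(x, b) \<in> u" "a \<noteq> b" "(x, c) \<in> u"
  shows "c = a \<or> c = b"
proof (rule ccontr)
  assume "\<not> ?thesis"
  then have "card {a, b, c} = 3" using assms by auto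
  moreover have "card {a, b, c} \<le> card (u `` {x})"
    using assms finite_image by (intro card_mono) auto
  moreover have "x \<in> \<Omega>" using assms basic_dom by blast
  ultimately show False using card_image[OF assms(1)] by fastforce
qed

subsection \<open>Thin relations\<close>

lemma thin_or_nonthin: "u \<in> S \<Longrightarrow> thin u \<or> nonthin u"
  unfolding thin_def nonthin_def by blast

lemma thin_not_nonthin: "thin u \<Longrightarrow> \<not> nonthin u"
  unfolding thin_def nonthin_def by blast

lemma thin_unique: "thin t \<Longrightarrow> (x, y) \<in> t \<Longrightarrow> (x, y') \<in> t \<Longrightarrow> y = y'"
  unfolding thin_def single_valued_def by blast

text \<open>Single-valuedness of \<open>t\<close> says that \<open>t\<inverse> O t\<close> lies in
  the diagonal, and by commutativity so does \<open>t O t\<inverse>\<close>.\<close>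

lemma thin_converse:
  assumes "thin t"
  shows "thin (t\<inverse>)"
proof -
  have "t O t\<inverse> = t\<inverse> O t" using basic_commute assms converse_closed thin_basic by blast
  moreover have "t\<inverse> O t \<subseteq> Id" using assms unfolding thin_def single_valued_def by blast
  ultimately have "single_valued (t\<inverse>)" unfolding single_valued_def by blast
  then show ?thesis using assms converse_closed unfolding thin_def by blast
qed

lemma nonthin_converse:
  assumes "nonthin u"
  shows "nonthin (u\<inverse>)"
proof -
  have "u\<inverse> \<in> S" using assms converse_closed nonthin_basic by simp
  moreover have "\<not> thin (u\<inverse>)" using thin_converse[of "u\<inverse>"] assms thin_not_nonthin by auto
  ultimately show ?thesis using thin_or_nonthin by auto
qed

lemma thin_diagonal: "thin (Id_on \<Omega>)"
  using diagonal_basic unfolding thin_def single_valued_def by auto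

lemma thin_comp_converse:
  assumes "thin t"
  shows "t O t\<inverse> = Id_on \<Omega>" "t\<inverse> O t = Id_on \<Omega>"
proof -
  have *: "t' O t'\<inverse> = Id_on \<Omega>" if t: "thin t'" for t'
  proof (rule subset_antisym; rule subrelI)
    fix x z assume "(x, z) \<in> t' O t'\<inverse>"
    then obtain y where "(x, y) \<in> t'" "(z, y) \<in> t'" by blast
    then have "x = z" "x \<in> \<Omega>"
      using thin_unique[OF thin_converse[OF t], of y x z] basic_dom[OF thin_basic[OF t]] by auto
    then show "(x, z) \<in> Id_on \<Omega>" by auto
  next
    fix x z assume "(x, z) \<in> Id_on \<Omega>"
    then have "x \<in> \<Omega>" "z = x" by auto
    moreover from this obtain y where "(x, y) \<in> t'" using basic_total thin_basic t by metis
    ultimately show "(x, z) \<in> t' O t'\<inverse>" by blast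
  qed
  show "t O t\<inverse> = Id_on \<Omega>" "t\<inverse> O t = Id_on \<Omega>"
    using *[OF assms] *[OF thin_converse[OF assms]] by simp_all
qed

text \<open>A basic \<open>w\<close> inside the product satisfies
  \<open>u \<subseteq> w O t\<inverse>\<close>; multiplying by \<open>t\<close> and cancelling gives
  the reverse inclusion.\<close>

lemma comp_thin_basic:
  assumes "u \<in> S" "thin t"
  shows "u O t \<in> S"
proof -
  have t: "t \<in> S" using assms thin_basic by blast
  obtain x y where y: "(x, y) \<in> u" using basic_nonempty assms by blast
  then obtain z where z: "(y, z) \<in> t" using basic_total t basic_dom assms by metis
  obtain w where w: "w \<in> S" "(x, z) \<in> w" using basic_ex y z basic_dom assms t by metis
  have "w \<subseteq> u O t" using comp_transfer assms t w y z by blast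
  moreover have "u \<subseteq> w O t\<inverse>"
    using comp_transfer[OF w(1) converse_closed[OF t] assms(1) w(2) _ y] z by blast
  then have "u O t \<subseteq> (w O t\<inverse>) O t" by blast
  then have "u O t \<subseteq> w"
    using thin_comp_converse(2)[OF assms(2)] diagonal_comp saturated_basic w by (simp add: O_assoc)
  ultimately show ?thesis using w subset_antisym[of w "u O t"] by simp
qed

lemma thin_comp_basic: "u \<in> S \<Longrightarrow> thin t \<Longrightarrow> t O u \<in> S"
  using comp_thin_basic[of u t] basic_commute[of u t] thin_basic[of t] by simp

lemma thin_comp: "thin t \<Longrightarrow> thin t' \<Longrightarrow> thin (t O t')"
  using comp_thin_basic[of t t'] single_valued_relcomp[of t t'] unfolding thin_def by simp

subsection \<open>Products of two relations and orthogonals\<close>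

text \<open>An edge of \<open>r\<close> gives one triangle with sides \<open>v\<close>,
  \<open>w\<close>, \<open>r\<close>; \<open>comp_transfer\<close> along its side \<open>v\<close>
  puts such a triangle over every edge of \<open>v\<close>.\<close>

lemma product_at:
  assumes "v \<in> S" "w \<in> S" "r \<in> S" "r \<subseteq> v\<inverse> O w" "(x, y) \<in> v"
  obtains z where "(x, z) \<in> w" "(y, z) \<in> r"
proof -
  obtain a b where ab: "(a, b) \<in> r" using basic_nonempty assms(3) by metis
  then obtain c where c: "(c, a) \<in> v" "(c, b) \<in> w" using assms(4) by blast
  have "v \<subseteq> w O r\<inverse>"
    using comp_transfer[OF assms(2) converse_closed[OF assms(3)] assms(1) c(2) _ c(1)] ab by simp
  then show ?thesis using that assms(5) by blast
qed

text \<open>Over a fixed edge of \<open>a\<inverse>\<close> from \<open>x\<close>, each constituent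
  of the product leads to a different one of the at most two \<open>b\<close>-neighbours of
  \<open>x\<close>.\<close>

lemma two_basics:
  assumes "a \<in> S" "b \<in> S" "r \<in> S" "r' \<in> S" "r'' \<in> S" "r \<noteq> r'"
    and "r \<subseteq> a O b" "r' \<subseteq> a O b" "r'' \<subseteq> a O b"
  shows "r'' = r \<or> r'' = r'"
proof -
  have a: "a\<inverse> \<in> S" "(a\<inverse>)\<inverse> = a" using converse_closed assms(1) by auto
  obtain y x where xy: "(x, y) \<in> a\<inverse>" using basic_nonempty a(1) by metis
  have at: "\<exists>z. (x, z) \<in> b \<and> (y, z) \<in> q" if "q \<in> S" "q \<subseteq> a O b" for q
    using product_at[OF a(1) assms(2) that(1) _ xy] that(2) a(2) by metis
  obtain z z' z'' where z: "(x, z) \<in> b" "(y, z) \<in> r" "(x, z') \<in> b" "(y, z') \<in> r'"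
      "(x, z'') \<in> b" "(y, z'') \<in> r''"
    using at assms by metis
  have "z \<noteq> z'" using z basic_eq assms by metis
  then have "z'' = z \<or> z'' = z'" using image_two[OF assms(2)] z by metis
  then show ?thesis using z basic_eq assms by metis
qed

text \<open>Each of the four points lies on an \<open>r\<close>-edge between the two neighbourhoods.
  If \<open>(x', y')\<close> were not in \<open>r\<close>, then \<open>(x', y)\<close> and
  \<open>(x, y')\<close> would be, so only \<open>r\<close> would occur at \<open>x\<close>; but the
  relation of \<open>(x', y')\<close> must occur there as well.\<close>

lemma matching:
  assumes "v \<in> S" "w \<in> S" "r \<in> S" "(a, x) \<in> v" "(a, x') \<in> v" "x \<noteq> x'"
    and "(a, y) \<in> w" "(a, y') \<in> w" "y \<noteq> y'" "(x, y) \<in> r"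
  shows "(x', y') \<in> r"
proof (rule ccontr)
  assume n: "(x', y') \<notin> r"
  have r: "r \<subseteq> v\<inverse> O w"
    using comp_transfer[OF converse_closed[OF assms(1)] assms(2,3), of x a y] assms by simp
  have xy': "(x', y) \<in> r"
    using product_at[OF assms(1,2,3) r assms(5)] image_two[OF assms(2,7,8,9)] n by metis
  have "r\<inverse> \<subseteq> w\<inverse> O v" using r by blast
  then have yx: "(x, y') \<in> r"
    using product_at[OF assms(2,1) converse_closed[OF assms(3)] _ assms(8)]
      image_two[OF assms(1,4,5,6)] n converse_iff by metis
  have "x' \<in> \<Omega>" "y' \<in> \<Omega>" using basic_dom assms by auto
  then obtain q where q: "q \<in> S" "(x', y') \<in> q" using basic_ex by metis
  have "q \<subseteq> v\<inverse> O w"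
    using comp_transfer[OF converse_closed[OF assms(1)] assms(2) q(1), of x' a y'] assms q by simp
  then have "(x, y) \<in> q \<or> (x, y') \<in> q"
    using product_at[OF assms(1,2) q(1) _ assms(4)] image_two[OF assms(2,7,8,9)] by metis
  then have "q = r" using basic_eq[OF q(1) assms(3)] assms(10) yx by metis
  then show False using n q by simp
qed

text \<open>Take the relation \<open>p\<close> of one pair of distinct \<open>u\<close>-neighbours.
  It occurs over every edge of \<open>u\<close> and avoids the diagonal, so over
  \<open>(y, b)\<close> it must lead from \<open>b\<close> to the other \<open>u\<close>-neighbour
  of \<open>y\<close>.\<close>

lemma perp_basic:
  assumes "nonthin u"
  shows "perp u \<in> S"
proof -
  have u: "u \<in> S" using assms nonthin_basic by simp
  obtain x a where a: "(x, a) \<in> u" using basic_nonempty u by metis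
  obtain a' where a': "a' \<noteq> a" "(x, a') \<in> u" using nonthin_other assms a by metis
  obtain p where p: "p \<in> S" "(a, a') \<in> p" using basic_ex basic_dom[OF u] a a' by metis
  have pu: "p \<subseteq> u\<inverse> O u"
    using comp_transfer[OF converse_closed[OF u] u p(1), of a x a'] a a' p by simp
  have "p \<inter> Id = {}"
  proof (rule ccontr)
    assume "p \<inter> Id \<noteq> {}"
    then obtain z where z: "(z, z) \<in> p" by auto
    then have "(z, z) \<in> Id_on \<Omega>" using basic_dom p by auto
    then have "p = Id_on \<Omega>" using basic_eq[OF p(1) diagonal_basic z] by simp
    then show False using p a' by auto
  qed
  then have "p \<subseteq> perp u" using pu unfolding perp_def by blast
  moreover have "perp u \<subseteq> p"
  proof (rule subrelI)
    fix b b' assume "(b, b') \<in> perp u"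
    then obtain y where y: "(y, b) \<in> u" "(y, b') \<in> u" "b \<noteq> b'" unfolding perp_def by auto
    obtain z where z: "(y, z) \<in> u" "(b, z) \<in> p"
      using product_at[OF u u p(1) pu y(1)] by metis
    have "z \<noteq> b" using z \<open>p \<inter> Id = {}\<close> by auto
    then show "(b, b') \<in> p" using image_two[OF u y z(1)] z by metis
  qed
  ultimately show ?thesis using p by (metis subset_antisym)
qed

lemma perp_sym: "(perp u)\<inverse> = perp u"
  unfolding perp_def by auto

lemma perpI: "(x, a) \<in> u \<Longrightarrow> (x, b) \<in> u \<Longrightarrow> a \<noteq> b \<Longrightarrow> (a, b) \<in> perp u"
  unfolding perp_def by auto

lemma perp_converse:
  assumes "u \<in> S"
  shows "perp (u\<inverse>) = perp u"
  unfolding perp_def using basic_commute[OF assms converse_closed[OF assms]] by simp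

lemma perp_neq_diagonal:
  assumes "nonthin u"
  shows "perp u \<noteq> Id_on \<Omega>"
proof
  assume u: "perp u = Id_on \<Omega>"
  obtain x y where "(x, y) \<in> perp u" using basic_nonempty perp_basic assms by metis
  moreover from this have "x = y" unfolding u by auto
  ultimately show False unfolding perp_def by simp
qed

lemma converse_comp_self:
  assumes "u \<in> S"
  shows "u\<inverse> O u = Id_on \<Omega> \<union> perp u"
proof (rule subset_antisym; rule subrelI)
  fix a b assume "(a, b) \<in> u\<inverse> O u"
  then show "(a, b) \<in> Id_on \<Omega> \<union> perp u" using basic_dom[OF assms] unfolding perp_def by blast
next
  fix a b assume ab: "(a, b) \<in> Id_on \<Omega> \<union> perp u"
  show "(a, b) \<in> u\<inverse> O u"
  proof (cases "(a, b) \<in> perp u")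
    case False
    then have "a \<in> \<Omega>" "b = a" using ab by auto
    then obtain x where "(a, x) \<in> u\<inverse>" using basic_total converse_closed[OF assms] by metis
    then show ?thesis using \<open>b = a\<close> by auto
  qed (auto simp: perp_def)
qed

lemma comp_converse_self:
  assumes "u \<in> S"
  shows "u O u\<inverse> = Id_on \<Omega> \<union> perp u"
  using converse_comp_self[OF assms] basic_commute[OF assms converse_closed[OF assms]] by simp

lemma thin_in_product:
  assumes "v \<in> S" "w \<in> S" "thin t" "t \<subseteq> v\<inverse> O w"
  shows "w = v O t"
proof -
  obtain x y where xy: "(x, y) \<in> v" using basic_nonempty assms(1) by metis
  obtain z where z: "(x, z) \<in> w" "(y, z) \<in> t"
    using product_at[OF assms(1,2) thin_basic[OF assms(3)] assms(4) xy] by metis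
  then have "(x, z) \<in> v O t" using xy by auto
  then show ?thesis by (rule basic_eq[OF assms(2) comp_thin_basic[OF assms(1,3)] z(1)])
qed

lemma perp_comp_thin:
  assumes "v \<in> S" "thin t"
  shows "perp (v O t) = perp v"
proof -
  have s: "saturated v" "saturated t" "saturated (v\<inverse>)" "saturated (t\<inverse>)"
    using assms saturated_basic saturated_converse thin_basic by auto
  have "(v O t)\<inverse> O (v O t) = t\<inverse> O ((v\<inverse> O v) O t)" by auto
  also have "\<dots> = t\<inverse> O (t O (v\<inverse> O v))"
    using saturated_commute[OF s(2) saturated_comp[OF s(3,1)]] by simp
  also have "\<dots> = (t\<inverse> O t) O (v\<inverse> O v)" by (simp add: O_assoc)
  also have "\<dots> = v\<inverse> O v"
    using thin_comp_converse(2)[OF assms(2)] diagonal_comp(1)[OF saturated_comp[OF s(3,1)]] by simp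
  finally show ?thesis unfolding perp_def by simp
qed

lemma nonthin_comp_thin:
  assumes "nonthin v" "thin t"
  shows "nonthin (v O t)"
proof -
  have "v O t \<in> S" using comp_thin_basic assms nonthin_basic by simp
  moreover have "\<not> thin (v O t)"
  proof
    assume "thin (v O t)"
    then have "thin ((v O t) O t\<inverse>)" using thin_comp thin_converse assms(2) by simp
    then show False
      using thin_comp_converse(1)[OF assms(2)] diagonal_comp(2)[OF saturated_basic] assms
        nonthin_basic thin_not_nonthin by (simp add: O_assoc)
  qed
  ultimately show ?thesis using thin_or_nonthin by auto
qed

text \<open>By \<open>product_at\<close> every constituent of the product occurs on an edge from
  \<open>x\<close> to \<open>y\<close> or \<open>y'\<close>, and both of these lie in
  \<open>r\<close>.\<close>

lemma product_eq_basic: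
  assumes "v \<in> S" "w \<in> S" "r \<in> S" "(a, x) \<in> v" "(a, y) \<in> w" "(a, y') \<in> w" "y \<noteq> y'"
    and "(x, y) \<in> r" "(x, y') \<in> r"
  shows "v\<inverse> O w = r"
proof
  have sat: "saturated (v\<inverse> O w)"
    using saturated_comp saturated_converse saturated_basic assms by metis
  show "r \<subseteq> v\<inverse> O w" using saturatedD[OF sat assms(3,8)] assms(4,5) by auto
  show "v\<inverse> O w \<subseteq> r"
  proof (rule subrelI)
    fix c d assume "(c, d) \<in> v\<inverse> O w"
    then obtain q where q: "q \<in> S" "(c, d) \<in> q" "q \<subseteq> v\<inverse> O w" using saturated_ex sat by metis
    obtain z where "(a, z) \<in> w" "(x, z) \<in> q" using product_at[OF assms(1,2) q(1,3) assms(4)] by metis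
    then have "(x, y) \<in> q \<or> (x, y') \<in> q" using image_two[OF assms(2,5,6,7)] by metis
    then have "q = r" using basic_eq[OF q(1) assms(3)] assms(8,9) by metis
    then show "(c, d) \<in> r" using q by simp
  qed
qed

text \<open>By \<open>matching\<close> the edges between the two neighbourhoods form a 4-cycle
  alternating between \<open>r\<close> and \<open>r'\<close>; its diagonals lie in
  \<open>perp v\<close> and \<open>perp w\<close>.\<close>

lemma perp_in_difference:
  assumes "nonthin v" "nonthin w" "r \<in> S" "r' \<in> S" "r \<noteq> r'"
    and "r \<subseteq> v\<inverse> O w" "r' \<subseteq> v\<inverse> O w"
  shows "perp v \<subseteq> r O r'\<inverse>" "perp w \<subseteq> r O r'\<inverse>"
proof -
  have vw: "v \<in> S" "w \<in> S" using assms nonthin_basic by auto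
  have r: "saturated r" "saturated r'" "saturated (r\<inverse>)" "saturated (r'\<inverse>)"
    using assms saturated_basic saturated_converse by auto
  obtain a x where x: "(a, x) \<in> v" using basic_nonempty vw(1) by metis
  obtain x' where x': "x' \<noteq> x" "(a, x') \<in> v" using nonthin_other assms(1) x by metis
  obtain y where y: "(a, y) \<in> w" "(x, y) \<in> r" using product_at[OF vw assms(3,6) x] by metis
  obtain y' where y': "(a, y') \<in> w" "(x, y') \<in> r'" using product_at[OF vw assms(4,7) x] by metis
  have ne: "y \<noteq> y'" using y y' basic_eq assms by metis
  have "(x', y) \<in> r'" using matching[OF vw assms(4) x x'(2) _ y'(1) y(1) _ y'(2)] x' ne by auto
  then have "(x, x') \<in> r O r'\<inverse>" using y by auto
  moreover have "(x, x') \<in> perp v" using perpI x x' by metis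
  ultimately show "perp v \<subseteq> r O r'\<inverse>"
    using saturatedD saturated_comp r perp_basic assms(1) by metis
  have "(y', y) \<in> r'\<inverse> O r" using y y' by auto
  then have "(y', y) \<in> r O r'\<inverse>" using saturated_commute r by metis
  moreover have "(y', y) \<in> perp w" using perpI y y' ne by metis
  ultimately show "perp w \<subseteq> r O r'\<inverse>"
    using saturatedD saturated_comp r perp_basic assms(2) by metis
qed

text \<open>The two \<open>v\<close>-predecessors \<open>a\<close>, \<open>a'\<close> of
  \<open>x\<close> are joined by the common orthogonal, hence have a common
  \<open>w\<close>-neighbour \<open>y\<close>. The relation \<open>r\<close> of
  \<open>(x, y)\<close> is thin: a second \<open>r\<close>-edge from \<open>x\<close> would arise
  from \<open>a\<close> or \<open>a'\<close>, and then \<open>r\<close> would be the only relation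
  from \<open>x\<close> to the \<open>w\<close>-neighbourhood of that point.\<close>

lemma perp_eq_cases:
  assumes "nonthin v" "nonthin w" "perp v = perp w" "v\<inverse> O w \<notin> S"
  obtains t where "thin t" "t \<subseteq> v\<inverse> O w"
proof -
  have vw: "v \<in> S" "w \<in> S" using assms nonthin_basic by auto
  obtain a x where x: "(a, x) \<in> v" using basic_nonempty vw(1) by metis
  obtain a' where a': "a' \<noteq> a" "(a', x) \<in> v"
    using nonthin_other[OF nonthin_converse[OF assms(1)]] x by (metis converse_iff)
  have "(a, a') \<in> perp (v\<inverse>)" using perpI[of x a "v\<inverse>" a'] x a' by auto
  then have "(a, a') \<in> perp (w\<inverse>)" using assms(3) perp_converse vw by simp
  then obtain y where y: "(a, y) \<in> w" "(a', y) \<in> w" unfolding perp_def by auto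
  obtain y' where y': "y' \<noteq> y" "(a, y') \<in> w" using nonthin_other assms(2) y by metis
  obtain r where r: "r \<in> S" "(x, y) \<in> r" using basic_ex basic_dom vw x y by metis
  obtain r' where r': "r' \<in> S" "(x, y') \<in> r'" using basic_ex basic_dom vw x y' by metis
  have sat: "saturated (v\<inverse> O w)"
    using saturated_comp saturated_converse saturated_basic vw by metis
  have rin: "r \<subseteq> v\<inverse> O w" "r' \<subseteq> v\<inverse> O w"
    using saturatedD[OF sat] r r' x y y' by blast+
  have "r \<noteq> r'"
  proof
    assume "r = r'"
    then have "v\<inverse> O w = r" using product_eq_basic[OF vw r(1) x y(1) y'(2)] y'(1) r r' by simp
    then show False using assms(4) r by simp
  qed
  have "thin r"
  proof (rule ccontr)
    assume "\<not> thin r"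
    then have "nonthin r" using thin_or_nonthin r by auto
    then obtain z where z: "z \<noteq> y" "(x, z) \<in> r" using nonthin_other r by metis
    then obtain b where b: "(b, x) \<in> v" "(b, z) \<in> w" using rin by blast
    have "b = a \<or> b = a'"
      using image_two[OF converse_closed[OF vw(1)], of x a a' b] x a' b by auto
    then show False
    proof
      assume "b = a"
      then have "z = y'" using image_two[OF vw(2) y(1) y'(2), of z] y' z b by auto
      then show False using basic_eq r r' z \<open>r \<noteq> r'\<close> by metis
    next
      assume "b = a'"
      obtain z' where z': "(a', z') \<in> w" "(x, z') \<in> r'"
        using product_at[OF vw r'(1) rin(2) a'(2)] by metis
      then have "z' = y \<or> z' = z" using image_two[OF vw(2) y(2)] b z \<open>b = a'\<close> by metis
      then show False using basic_eq r r' z z' \<open>r \<noteq> r'\<close> by metis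
    qed
  qed
  then show ?thesis using that rin by metis
qed

subsection \<open>Products that are basic\<close>

text \<open>All four edges between the neighbourhoods \<open>{x, x'}\<close> and
  \<open>{y, y'}\<close> of \<open>a\<close> lie in \<open>r\<close>, so each of the two pairs
  consists of neighbours of one point under \<open>r\<close> or \<open>r\<inverse>\<close>. This
  identifies the three orthogonals.\<close>

lemma single_product:
  assumes "nonthin v" "nonthin w" "v\<inverse> O w \<in> S"
  shows "nonthin (v\<inverse> O w)" "perp (v\<inverse> O w) = perp v" "perp w = perp v" "thin (perp v)"
proof -
  define r where "r = v\<inverse> O w"
  have vw: "v \<in> S" "w \<in> S" and r: "r \<in> S" using assms nonthin_basic r_def by auto
  have inr: "(c, d) \<in> r" if "(b, c) \<in> v" "(b, d) \<in> w" for b c d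
    using that r_def by auto
  obtain a x where x: "(a, x) \<in> v" using basic_nonempty vw(1) by metis
  obtain x' where x': "x' \<noteq> x" "(a, x') \<in> v" using nonthin_other assms(1) x by metis
  obtain y where y: "(a, y) \<in> w" using basic_total vw(2) basic_dom[OF vw(1) x] by metis
  obtain y' where y': "y' \<noteq> y" "(a, y') \<in> w" using nonthin_other assms(2) y by metis
  have rxy: "(x, y) \<in> r" "(x, y') \<in> r" "(x', y) \<in> r" "(x', y') \<in> r"
    using inr x x' y y' by auto
  have nr: "nonthin r" using r rxy(1,2) y'(1) unfolding nonthin_def single_valued_def by auto
  have pr: "(y, y') \<in> perp r" "(y, y') \<in> perp w" "(x, x') \<in> perp (r\<inverse>)" "(x, x') \<in> perp v"
    using perpI[OF rxy(1,2)] perpI[OF y y'(2)] perpI[of y x "r\<inverse>" x'] rxy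
      perpI[OF x x'(2)] x' y' by auto
  have prw: "perp r = perp w"
    using basic_eq[OF perp_basic[OF nr] perp_basic[OF assms(2)] pr(1,2)] .
  have prv: "perp r = perp v"
    using basic_eq[OF perp_basic[OF nr] perp_basic[OF assms(1)] _ pr(4)] pr(3)
      perp_converse[OF r] by simp
  \<comment> \<open>The second \<open>v\<close>-predecessor \<open>a'\<close> of \<open>x\<close>
    turns out to have the same \<open>v\<close>-neighbours as \<open>a\<close>. A point joined to
    \<open>a\<close> by \<open>perp v\<close> shares a \<open>v\<close>-neighbour with
    \<open>a\<close>, so it can only be \<open>a'\<close>; hence \<open>perp v\<close> is
    thin.\<close>
  obtain a' where a': "a' \<noteq> a" "(a', x) \<in> v"
    using nonthin_other[OF nonthin_converse[OF assms(1)]] x by (metis converse_iff)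
  have a'w: "z = y \<or> z = y'" if "(a', z) \<in> w" for z
    using inr[OF a'(2) that] image_two[OF r rxy(1,2)] y' by metis
  obtain z where z: "(a', z) \<in> w" using basic_total vw(2) basic_dom[OF vw(1) a'(2)] by metis
  have a'y: "(a', y) \<in> w"
    using nonthin_other[OF assms(2) z] a'w z by metis
  have a'v: "z = x \<or> z = x'" if "(a', z) \<in> v" for z
    using inr[OF that a'y] image_two[OF converse_closed[OF r], of y x x' z] rxy x' by auto
  have a'x': "(a', x') \<in> v" using nonthin_other[OF assms(1) a'(2)] a'v by metis
  have paa': "(a, a') \<in> perp v"
    using perpI[of x a "v\<inverse>" a'] x a' perp_converse[OF vw(1)] by auto
  have "thin (perp v)"
  proof (rule ccontr)
    assume "\<not> thin (perp v)"
    then have "nonthin (perp v)" using thin_or_nonthin perp_basic assms(1) by auto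
    then obtain b where b: "b \<noteq> a'" "(a, b) \<in> perp v" using nonthin_other paa' by metis
    then have "(a, b) \<in> perp (v\<inverse>)" using perp_converse[OF vw(1)] by simp
    then obtain c where c: "(a, c) \<in> v" "(b, c) \<in> v" "a \<noteq> b" unfolding perp_def by auto
    have "c = x \<or> c = x'" using image_two[OF vw(1) x x'(2) _ c(1)] x'(1) by simp
    then have "(a, c) \<in> v \<and> (a', c) \<in> v" using x x' a' a'x' by auto
    then have "b = a \<or> b = a'"
      using image_two[OF converse_closed[OF vw(1)], of c a a' b] c a'(1) by auto
    then show False using b c by simp
  qed
  then show "nonthin (v\<inverse> O w)" "perp (v\<inverse> O w) = perp v" "perp w = perp v" "thin (perp v)"
    using nr prv prw r_def by auto
qed

lemma basic_in_union:
  assumes "r \<in> S" "a \<in> S" "b \<in> S" "r \<subseteq> a \<union> b"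
  shows "r = a \<or> r = b"
proof -
  obtain x y where xy: "(x, y) \<in> r" using basic_nonempty assms(1) by metis
  then have "(x, y) \<in> a \<or> (x, y) \<in> b" using assms(4) by auto
  then show ?thesis using basic_eq xy assms(1-3) by metis
qed

lemma comp_thin_cancel:
  assumes "saturated R" "thin t"
  shows "(R O t) O t\<inverse> = R" "(R O t\<inverse>) O t = R"
  using thin_comp_converse[OF assms(2)] diagonal_comp(2)[OF assms(1)] by (simp_all add: O_assoc)

lemma perp_thin_square:
  assumes "thin (perp u)"
  shows "perp u O perp u = Id_on \<Omega>"
  using thin_comp_converse(1)[OF assms] perp_sym by simp

lemma converse_comp_thin_multiple:
  assumes "v \<in> S"
  shows "v\<inverse> O (v O t) = Id_on \<Omega> O t \<union> perp v O t"
proof -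
  have "v\<inverse> O (v O t) = (v\<inverse> O v) O t" by auto
  then show ?thesis unfolding converse_comp_self[OF assms] by auto
qed

text \<open>A thin \<open>t\<close> in the product gives \<open>w = v O t\<close>, so the whole
  product is \<open>t \<union> perp v O t\<close>.\<close>

lemma perp_eq_all_thin:
  assumes "nonthin v" "nonthin w" "perp v = perp w" "v\<inverse> O w \<notin> S" "thin (perp v)"
    and "r \<in> S" "r \<subseteq> v\<inverse> O w"
  shows "thin r"
proof -
  have vw: "v \<in> S" "w \<in> S" using assms nonthin_basic by auto
  obtain t where t: "thin t" "t \<subseteq> v\<inverse> O w" using perp_eq_cases assms by metis
  have "w = v O t" using thin_in_product[OF vw t] .
  then have "v\<inverse> O w = t \<union> perp v O t"
    using converse_comp_thin_multiple[OF vw(1), of t]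
      diagonal_comp(1)[OF saturated_basic[OF thin_basic[OF t(1)]]] by simp
  moreover have "thin (perp v O t)" using thin_comp assms t by simp
  ultimately show ?thesis using basic_in_union assms(6,7) t thin_basic by metis
qed

lemma product_other:
  assumes "saturated R" "R \<notin> S" "r \<in> S" "r \<subseteq> R"
  obtains r' where "r' \<in> S" "r' \<noteq> r" "r' \<subseteq> R"
proof -
  have "r \<noteq> R" using assms by auto
  then obtain x y where xy: "(x, y) \<in> R" "(x, y) \<notin> r" using assms(4) by auto
  then obtain r' where "r' \<in> S" "(x, y) \<in> r'" "r' \<subseteq> R" using saturated_ex assms(1) by metis
  then show ?thesis using that xy by metis
qed

text \<open>If \<open>h\<close> were thin, \<open>g\<close> would be a thin multiple of
  \<open>u\<inverse>\<close> and have the same orthogonal. For another constituent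
  \<open>h'\<close>, both orthogonals lie in \<open>h O h'\<inverse>\<close>; as
  \<open>perp u\<close> is thin, this product is \<open>perp u \<union> perp h O perp u\<close>, so
  \<open>perp g\<close> is its second part.\<close>

lemma perp_in_product:
  assumes "nonthin u" "nonthin g" "thin (perp u)" "perp g \<noteq> perp u" "h \<in> S" "h \<subseteq> u O g"
  shows "nonthin h" "perp h = perp g O perp u"
proof -
  have ug: "u \<in> S" "g \<in> S" "u\<inverse> \<in> S" using assms nonthin_basic converse_closed by auto
  have nu: "nonthin (u\<inverse>)" "perp (u\<inverse>) = perp u"
    using assms nonthin_converse perp_converse ug by auto
  have e: "u O g = (u\<inverse>)\<inverse> O g" by simp
  show h: "nonthin h"
  proof (rule ccontr)
    assume "\<not> nonthin h"
    then have h: "thin h" using thin_or_nonthin assms(5) by auto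
    then have "g = u\<inverse> O h" using thin_in_product[OF ug(3,2)] assms(6) by simp
    then show False using perp_comp_thin[OF ug(3) h] assms(4) nu(2) by simp
  qed
  have sat: "saturated (u O g)" using saturated_comp saturated_basic ug by simp
  have "u O g \<notin> S" using single_product(3)[OF nu(1) assms(2)] assms(4) nu(2) by auto
  then obtain h' where h': "h' \<in> S" "h' \<noteq> h" "h' \<subseteq> u O g"
    using product_other sat assms(5,6) by metis
  have p: "perp u \<subseteq> h O h'\<inverse>" "perp g \<subseteq> h O h'\<inverse>"
    using perp_in_difference[OF nu(1) assms(2,5) h'(1)] h' assms(6) nu(2) by auto
  have hS: "h\<inverse> \<in> S" "h'\<inverse> \<in> S" using converse_closed assms h' by auto
  have "h'\<inverse> = h\<inverse> O perp u"
    using thin_in_product[OF hS assms(3)] p(1) by simp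
  then have "h O h'\<inverse> = (h\<inverse>)\<inverse> O (h\<inverse> O perp u)" by simp
  also have "\<dots> = perp u \<union> perp h O perp u"
    unfolding converse_comp_thin_multiple[OF hS(1)] perp_converse[OF assms(5)]
    using diagonal_comp(1)[OF saturated_basic] thin_basic assms(3) by simp
  finally have "perp g \<subseteq> perp u \<union> perp h O perp u" using p(2) by simp
  moreover have "perp h O perp u \<in> S" using comp_thin_basic perp_basic h assms(3) by simp
  ultimately have "perp g = perp h O perp u"
    using basic_in_union perp_basic assms(1,2,4) by metis
  then show "perp h = perp g O perp u"
    using comp_thin_cancel(1)[OF saturated_basic[OF perp_basic[OF h]] assms(3)] perp_sym by simp
qed

text \<open>Take constituents \<open>h\<close> of \<open>u O g\<close> and \<open>k\<close> of
  \<open>v O g\<close>. Both have orthogonal \<open>perp g O perp u\<close>, and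
  \<open>h\<inverse> O k \<subseteq> w \<union> w O perp g\<close>. A thin relation in
  \<open>h\<inverse> O k\<close> is not the nonthin \<open>w\<close>, so it lies in
  \<open>w O perp g\<close>, and solving for \<open>perp g\<close> makes it a thin multiple of
  \<open>w\<inverse>\<close>. The conclusions are shown to be contradictory in the next
  lemma.\<close>

lemma single_product_step:
  assumes "nonthin u" "nonthin v" "u\<inverse> O v \<in> S" "nonthin g" "perp g \<noteq> perp u"
  shows "nonthin (perp g)" "perp (perp g) = perp u" "\<exists>t. thin t \<and> u\<inverse> O v = t O perp g"
proof -
  define w q z where "w = u\<inverse> O v" and "q = perp g" and "z = perp u"
  have S: "u \<in> S" "v \<in> S" "g \<in> S" "w \<in> S" "q \<in> S"
    using assms nonthin_basic perp_basic w_def q_def by auto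
  note sat = S[THEN saturated_basic] S(1-3)[THEN saturated_basic, THEN saturated_converse]
  have w: "nonthin w" "perp w = z" "perp v = z" "thin z"
    using single_product[OF assms(1-3)] w_def z_def by auto
  have qz: "q \<noteq> z" using assms(5) q_def z_def by simp
  have zz: "(q O z) O z = q"
    using comp_thin_cancel(1)[OF sat(5) w(4)] perp_sym z_def by metis
  obtain h where h: "h \<in> S" "h \<subseteq> u O g"
  proof -
    obtain x y where xy: "(x, y) \<in> u" using basic_nonempty S by metis
    then obtain y' where "(y, y') \<in> g" using basic_total basic_dom S by metis
    then have "(x, y') \<in> u O g" using xy by auto
    then show ?thesis using that saturated_ex[OF saturated_comp[OF sat(1,3)]] by metis
  qed
  obtain k where k: "k \<in> S" "k \<subseteq> v O g"
  proof -
    obtain x y where xy: "(x, y) \<in> v" using basic_nonempty S by metis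
    then obtain y' where "(y, y') \<in> g" using basic_total basic_dom S by metis
    then have "(x, y') \<in> v O g" using xy by auto
    then show ?thesis using that saturated_ex[OF saturated_comp[OF sat(2,3)]] by metis
  qed
  have nh: "nonthin h" "perp h = q O z"
    using perp_in_product[OF assms(1,4) _ assms(5) h] w(4) q_def z_def by auto
  have nk: "nonthin k" "perp k = q O z"
    using perp_in_product[OF assms(2,4) _ _ k] w(3,4) qz q_def z_def by auto
  have "h\<inverse> O k \<subseteq> (u O g)\<inverse> O (v O g)" using h k by auto
  also have "\<dots> = g\<inverse> O (w O g)" unfolding w_def by auto
  also have "\<dots> = w O (g\<inverse> O g)" using saturated_left_commute[OF sat(8,4)] .
  also have "\<dots> = w \<union> w O q"
    unfolding converse_comp_self[OF S(3)] q_def[symmetric]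
    using diagonal_comp(2)[OF sat(4)] by auto
  finally have hk: "h\<inverse> O k \<subseteq> w \<union> w O q" .
  \<comment> \<open>If it were basic, \<open>q\<close> would be thin, so \<open>w O q\<close> would
    be basic with orthogonal \<open>z\<close>. Comparing orthogonals gives \<open>q O z = z\<close>,
    which makes \<open>q\<close> the diagonal.\<close>
  have "h\<inverse> O k \<notin> S"
  proof
    assume m: "h\<inverse> O k \<in> S"
    note sp = single_product[OF nh(1) nk(1) m]
    have "thin q" using thin_comp[of "q O z" z] sp(4) nh(2) w(4) zz by simp
    then have wq: "w O q \<in> S" "perp (w O q) = z"
      using comp_thin_basic perp_comp_thin S(4) w(2) by auto
    have "h\<inverse> O k = w \<or> h\<inverse> O k = w O q" using basic_in_union[OF m S(4) wq(1) hk] .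
    then have "q O z = z" using sp(2) nh(2) w(2) wq(2) by auto
    then have "q = z O z" using zz by simp
    then show False
      using perp_thin_square[of u] w(4) z_def perp_neq_diagonal[OF assms(4)] q_def by simp
  qed
  then obtain t where t: "thin t" "t \<subseteq> h\<inverse> O k" using perp_eq_cases nh nk by metis
  have tS: "t \<in> S" using thin_basic t by simp
  obtain x y where xy: "(x, y) \<in> t" using basic_nonempty tS by metis
  have "(x, y) \<notin> w" using basic_eq[OF tS S(4) xy] w(1) t(1) thin_not_nonthin by auto
  then have "(x, y) \<in> w O q" using hk t xy by auto
  then have "t \<subseteq> (w\<inverse>)\<inverse> O q"
    using saturatedD[OF saturated_comp[OF sat(4,5)] tS xy] by simp
  then have q: "q = w\<inverse> O t" using thin_in_product[OF converse_closed[OF S(4)] S(5) t(1)] by simp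
  show "nonthin (perp g)"
    using nonthin_comp_thin[OF nonthin_converse[OF w(1)] t(1)] q q_def by simp
  show "perp (perp g) = perp u"
    using perp_comp_thin[OF converse_closed[OF S(4)] t(1)] perp_converse[OF S(4)] w(2) q q_def z_def
    by simp
  have "q = q\<inverse>" using perp_sym q_def by simp
  then have "q = t\<inverse> O w" using q by (simp add: converse_relcomp)
  then have "t O q = (t O t\<inverse>) O w" by (simp add: O_assoc)
  then have "t O q = w" using thin_comp_converse(1)[OF t(1)] diagonal_comp(1)[OF sat(4)] by simp
  then show "\<exists>t. thin t \<and> u\<inverse> O v = t O perp g" using t(1) w_def q_def by metis
qed

text \<open>Otherwise \<open>perp g\<close> is nonthin with orthogonal \<open>perp u\<close>, and it
  is a thin multiple of every nonthin \<open>x\<close> with this orthogonal, in particular of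
  \<open>u\<close> and of \<open>v\<close>. Then \<open>v\<close> is a thin multiple of
  \<open>u\<close>, and the nonthin basic relation \<open>u\<inverse> O v\<close> contains a thin
  one.\<close>

lemma single_product_unique_perp:
  assumes "nonthin u" "nonthin v" "u\<inverse> O v \<in> S" "nonthin g"
  shows "perp g = perp u"
proof (rule ccontr)
  assume ne: "perp g \<noteq> perp u"
  note step = single_product_step[OF assms ne]
  note sp = single_product[OF assms(1-3)]
  have q: "\<exists>t. thin t \<and> perp g = x O t" if x: "nonthin x" "perp x = perp u" for x
  proof -
    have xS: "x \<in> S" and qS: "perp g \<in> S" using x nonthin_basic step(1) by auto
    have "x\<inverse> O perp g \<notin> S"
    \<comment> \<open>By the preceding lemma, now with \<open>x\<close> and \<open>perp g\<close> as
      factors, the product would be \<open>t O perp g\<close>. Multiplying by the converse of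
      \<open>perp g\<close> turns both sides into multiples of
      \<open>Id_on \<Omega> \<union> perp u\<close>; the right one has only thin constituents, so
      \<open>x\<inverse>\<close> would be thin.\<close>
    proof
      assume m: "x\<inverse> O perp g \<in> S"
      have "perp g \<noteq> perp x" using ne x by simp
      then obtain t where t: "thin t" "x\<inverse> O perp g = t O perp g"
        using single_product_step(3)[OF x(1) step(1) m assms(4)] by auto
      have "x\<inverse> O (perp g O (perp g)\<inverse>) = t O (perp g O (perp g)\<inverse>)"
        using t(2) by (metis O_assoc)
      moreover have "perp g O (perp g)\<inverse> = Id_on \<Omega> \<union> perp u"
        using comp_converse_self[OF qS] step(2) by simp
      ultimately have "x\<inverse> O (Id_on \<Omega> \<union> perp u) = t O (Id_on \<Omega> \<union> perp u)" by simp
      moreover have "x\<inverse> O Id_on \<Omega> = x\<inverse>" "t O Id_on \<Omega> = t"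
        using diagonal_comp(2) saturated_basic converse_closed[OF xS] thin_basic[OF t(1)] by auto
      ultimately have "x\<inverse> \<subseteq> t \<union> t O perp u" by auto
      moreover have tp: "thin (t O perp u)" using thin_comp t(1) sp(4) by simp
      ultimately have "x\<inverse> = t \<or> x\<inverse> = t O perp u"
        using basic_in_union converse_closed[OF xS] thin_basic t(1) by metis
      then show False using nonthin_converse[OF x(1)] tp t(1) thin_not_nonthin by auto
    qed
    then obtain t where t: "thin t" "t \<subseteq> x\<inverse> O perp g"
      using perp_eq_cases[OF x(1) step(1)] x(2) step(2) by metis
    show ?thesis using t(1) thin_in_product[OF xS qS t] by metis
  qed
  obtain t where t: "thin t" "perp g = u O t" using q[OF assms(1)] by auto
  obtain t' where t': "thin t'" "perp g = v O t'" using q[OF assms(2) sp(3)] by auto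
  have uv: "u \<in> S" "v \<in> S" using assms nonthin_basic by auto
  have "v = u O (t O t'\<inverse>)"
    using comp_thin_cancel(1)[OF saturated_basic[OF uv(2)] t'(1)] t t' by (metis O_assoc)
  then have "u\<inverse> O v = u\<inverse> O (u O (t O t'\<inverse>))" by simp
  also have "\<dots> = t O t'\<inverse> \<union> perp u O (t O t'\<inverse>)"
    unfolding converse_comp_thin_multiple[OF uv(1)]
    using diagonal_comp(1)[OF saturated_basic] thin_basic thin_comp thin_converse t t' by simp
  finally have "t O t'\<inverse> \<subseteq> u\<inverse> O v" by auto
  moreover have tt: "thin (t O t'\<inverse>)" using thin_comp thin_converse t t' by simp
  ultimately have "t O t'\<inverse> = u\<inverse> O v" using basic_subset_eq thin_basic assms(3) by metis
  then show False using sp(1) tt thin_not_nonthin by simp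
qed

subsection \<open>Automorphisms\<close>

text \<open>Preserving every basic relation forces injectivity on \<open>\<Omega>\<close>, since
  only the diagonal can be mapped into the diagonal; bijectivity follows by finiteness in
  \<open>automorphism_bij\<close>. Values outside \<open>\<Omega>\<close> are arbitrary.\<close>

definition automorphism :: "('a \<Rightarrow> 'a) \<Rightarrow> bool" where
  "automorphism f \<longleftrightarrow> (\<forall>u\<in>S. \<forall>x y. (x, y) \<in> u \<longrightarrow> (f x, f y) \<in> u)"

lemma automorphismD: "automorphism f \<Longrightarrow> u \<in> S \<Longrightarrow> (x, y) \<in> u \<Longrightarrow> (f x, f y) \<in> u"
  unfolding automorphism_def by simp

lemma automorphismI:
  assumes "\<And>u x y. u \<in> S \<Longrightarrow> (x, y) \<in> u \<Longrightarrow> (f x, f y) \<in> u"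
  shows "automorphism f"
  unfolding automorphism_def using assms by simp

lemma in_product_basic:
  assumes "v\<inverse> O w \<in> S" "r \<in> S" "(a, x) \<in> v" "(a, y) \<in> w" "(x, y) \<in> r"
    and "(b, X) \<in> v" "(b, Y) \<in> w"
  shows "(X, Y) \<in> r"
proof -
  have "(x, y) \<in> v\<inverse> O w" using assms by auto
  then have "r = v\<inverse> O w" by (rule basic_eq[OF assms(2,1,5)])
  then show ?thesis using assms(6,7) by auto
qed

lemma thin_triangle:
  assumes "v \<in> S" "w \<in> S" "r \<in> S" "thin v \<or> thin w"
    and "(a, x) \<in> v" "(a, y) \<in> w" "(x, y) \<in> r" "(b, X) \<in> v" "(b, Y) \<in> w"
  shows "(X, Y) \<in> r"
proof -
  have "v\<inverse> O w \<in> S"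
    using assms(1,2,4) thin_comp_basic comp_thin_basic thin_converse converse_closed by metis
  then show ?thesis by (rule in_product_basic[OF _ assms(3,5-9)])
qed

text \<open>The map exchanges the points of every two-point neighbourhood of \<open>a\<close> at
  once. Edges between two such neighbourhoods are preserved by \<open>matching\<close>, all others
  by \<open>thin_triangle\<close>.\<close>

lemma swap_automorphism:
  assumes "u \<in> S" "(a, b) \<in> u" "(a, b') \<in> u"
  obtains f where "automorphism f" "f a = a" "f b = b'"
proof (cases "b = b'")
  case True
  then show ?thesis using that[of id] unfolding automorphism_def by simp
next
  case False
  define P where "P x x' \<longleftrightarrow> x' \<noteq> x \<and> (\<exists>v\<in>S. (a, x) \<in> v \<and> (a, x') \<in> v)" for x x'
  \<comment> \<open>\<open>P x x'\<close> has a solution exactly when the relation from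
    \<open>a\<close> to \<open>x\<close> is nonthin; points thinly joined to \<open>a\<close> stay
    fixed.\<close>
  define f where "f x = (if \<exists>x'. P x x' then SOME x'. P x x' else x)" for x
  have f: "P x (f x) \<or> f x = x \<and> (\<nexists>x'. P x x')" for x
    unfolding f_def using someI_ex[of "P x"] by auto
  have fv: "(a, f x) \<in> v" if "v \<in> S" "(a, x) \<in> v" for x v
    using f[of x] that basic_eq[OF that(1) _ that(2)] unfolding P_def by metis
  have fn: "f x \<noteq> x" if nv: "nonthin v" "(a, x) \<in> v" for x v
  proof -
    obtain x' where "x' \<noteq> x" "(a, x') \<in> v" using nonthin_other[OF nv] by metis
    then have "P x x'" unfolding P_def using nv nonthin_basic by auto
    then show ?thesis using f[of x] unfolding P_def by auto
  qed
  have aO: "a \<in> \<Omega>" using basic_dom assms by auto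
  have "automorphism f"
  proof (rule automorphismI)
    fix r x y assume r: "r \<in> S" "(x, y) \<in> r"
    obtain v where v: "v \<in> S" "(a, x) \<in> v" using basic_ex[of a x] aO basic_dom[OF r] by metis
    obtain w where w: "w \<in> S" "(a, y) \<in> w" using basic_ex[of a y] aO basic_dom[OF r] by metis
    show "(f x, f y) \<in> r"
    proof (cases "thin v \<or> thin w")
      case True
      then show ?thesis
        using thin_triangle[OF v(1) w(1) r(1) True v(2) w(2) r(2) fv[OF v] fv[OF w]] by simp
    next
      case False
      then have "f x \<noteq> x" "f y \<noteq> y" using fn thin_or_nonthin v w by auto
      then show ?thesis
        using matching[OF v(1) w(1) r(1) v(2) fv[OF v] _ w(2) fv[OF w] _ r(2)] by simp
    qed
  qed
  moreover have "f a = a"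
  proof -
    have "(a, a) \<in> Id_on \<Omega>" using aO by (rule Id_onI)
    then have "(a, f a) \<in> Id_on \<Omega>" by (rule fv[OF diagonal_basic])
    then show ?thesis by auto
  qed
  moreover have "f b = b'"
  proof -
    have "nonthin u" using assms False unfolding nonthin_def single_valued_def by auto
    then have "f b \<noteq> b" using fn assms(2) by simp
    then show ?thesis using image_two[OF assms(1-3) False fv[OF assms(1,2)]] by simp
  qed
  ultimately show ?thesis using that by simp
qed

lemma translation_automorphism:
  assumes "thin t" "(a, b) \<in> t"
  obtains f where "automorphism f" "f a = b"
proof -
  define f where "f x = (SOME y. (x, y) \<in> t)" for x
  have tS: "t \<in> S" using thin_basic assms by simp
  have f: "(x, f x) \<in> t" if "x \<in> \<Omega>" for x
    unfolding f_def using basic_total[OF tS that] by (metis someI_ex)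
  have "automorphism f"
  proof (rule automorphismI)
    fix u x y assume u: "u \<in> S" "(x, y) \<in> u"
    then have "(x, f x) \<in> t" "(y, f y) \<in> t" using f basic_dom by auto
    then have "(f x, f y) \<in> t\<inverse> O (u O t)" using u by auto
    also have "t\<inverse> O (u O t) = u"
    proof -
      have "u O t = t O u" using basic_commute u tS by simp
      then have "t\<inverse> O (u O t) = (t\<inverse> O t) O u" by auto
      then show ?thesis
        using thin_comp_converse(2)[OF assms(1)] diagonal_comp(1)[OF saturated_basic[OF u(1)]] by simp
    qed
    finally show "(f x, f y) \<in> u" .
  qed
  moreover have "f a = b" using f thin_unique[OF assms(1)] assms(2) basic_dom[OF tS] by metis
  ultimately show ?thesis using that by simp
qed

text \<open>All orthogonals equal the thin \<open>perp u\<close>, so a product of two nonthin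
  relations is either basic or has only thin constituents. In the first case the relations to
  \<open>b\<close> alone decide the relation of the images; in the second the two points lie in one
  orbit of the thin relations.\<close>

lemma transitive_if_single_product:
  assumes "nonthin u" "nonthin v" "u\<inverse> O v \<in> S" "a \<in> \<Omega>" "b \<in> \<Omega>"
  obtains f where "automorphism f" "f a = b"
proof -
  have perp: "perp g = perp u" if "nonthin g" for g
    using single_product_unique_perp[OF assms(1-3) that] .
  have z: "thin (perp u)" using single_product(4)[OF assms(1-3)] .
  \<comment> \<open>\<open>T x\<close> is the orbit of \<open>x\<close> under thin relations and
    \<open>rep x\<close> one point of it. \<open>h\<close> chooses an image with the right relation
    to \<open>b\<close>; \<open>f\<close> uses it at \<open>rep x\<close> only and continues along
    the thin relation to \<open>x\<close>.\<close>
  define T where "T x = {y. \<exists>t. thin t \<and> (y, x) \<in> t}" for x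
  define rep where "rep x = (SOME y. y \<in> T x)" for x
  define h where "h y = (SOME c. \<exists>v\<in>S. (a, y) \<in> v \<and> (b, c) \<in> v)" for y
  define f where "f x = (SOME c. \<exists>t. thin t \<and> (rep x, x) \<in> t \<and> (h (rep x), c) \<in> t)" for x
  have T_eq: "T x = T y" if t: "thin t" "(x, y) \<in> t" for x y t
  proof
    have t': "thin (t\<inverse>)" using thin_converse t(1) .
    show "T x \<subseteq> T y"
    proof
      fix c assume "c \<in> T x"
      then obtain q where "thin q" "(c, x) \<in> q" unfolding T_def by auto
      then have "thin (q O t)" "(c, y) \<in> q O t" using thin_comp t by auto
      then show "c \<in> T y" unfolding T_def by blast
    qed
    show "T y \<subseteq> T x"
    proof
      fix c assume "c \<in> T y"
      then obtain q where "thin q" "(c, y) \<in> q" unfolding T_def by auto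
      then have "thin (q O t\<inverse>)" "(c, x) \<in> q O t\<inverse>" using thin_comp t t' by auto
      then show "c \<in> T x" unfolding T_def by blast
    qed
  qed
  have rep: "\<exists>t. thin t \<and> (rep x, x) \<in> t" if x: "x \<in> \<Omega>" for x
  proof -
    have "x \<in> T x" unfolding T_def using thin_diagonal x by (auto intro!: exI[of _ "Id_on \<Omega>"])
    then have "rep x \<in> T x" unfolding rep_def by (rule someI)
    then show ?thesis unfolding T_def by simp
  qed
  have h: "\<exists>v\<in>S. (a, y) \<in> v \<and> (b, h y) \<in> v" if y: "y \<in> \<Omega>" for y
  proof -
    obtain v where v: "v \<in> S" "(a, y) \<in> v" using basic_ex assms(4) y by metis
    then obtain c where "(b, c) \<in> v" using basic_total assms(5) by metis
    then have "\<exists>c. \<exists>v\<in>S. (a, y) \<in> v \<and> (b, c) \<in> v" using v by auto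
    then show ?thesis unfolding h_def by (rule someI_ex)
  qed
  have f: "\<exists>t. thin t \<and> (rep x, x) \<in> t \<and> (h (rep x), f x) \<in> t" if x: "x \<in> \<Omega>" for x
  proof -
    obtain t where t: "thin t" "(rep x, x) \<in> t" using rep x by metis
    then have "h (rep x) \<in> \<Omega>" using h[of "rep x"] basic_dom thin_basic by metis
    then obtain c where "(h (rep x), c) \<in> t" using basic_total thin_basic t(1) by metis
    then have "\<exists>c t. thin t \<and> (rep x, x) \<in> t \<and> (h (rep x), c) \<in> t" using t by auto
    then show ?thesis unfolding f_def by (rule someI_ex)
  qed
  have fib: "\<exists>v\<in>S. (a, x) \<in> v \<and> (b, f x) \<in> v" if x: "x \<in> \<Omega>" for x
  proof -
    obtain t where t: "thin t" "(rep x, x) \<in> t" "(h (rep x), f x) \<in> t" using f x by metis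
    then obtain v where "v \<in> S" "(a, rep x) \<in> v" "(b, h (rep x)) \<in> v"
      using h[of "rep x"] basic_dom thin_basic by metis
    then show ?thesis using comp_thin_basic[of v t] t by blast
  qed
  have same: "(f x, f y) \<in> r" if r: "r \<in> S" "(x, y) \<in> r" "rep x = rep y" for r x y
  proof -
    have "x \<in> \<Omega>" "y \<in> \<Omega>" using basic_dom r by auto
    then obtain t q where tq: "thin t" "(rep x, x) \<in> t" "(h (rep x), f x) \<in> t"
        "thin q" "(rep y, y) \<in> q" "(h (rep y), f y) \<in> q"
      using f by metis
    show ?thesis
      using thin_triangle[of t q r "rep x" x y "h (rep x)" "f x" "f y"] tq r thin_basic by simp
  qed
  have "automorphism f"
  proof (rule automorphismI)
    fix r x y assume r: "r \<in> S" "(x, y) \<in> r"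
    obtain v where v: "v \<in> S" "(a, x) \<in> v" "(b, f x) \<in> v" using fib[of x] basic_dom[OF r] by auto
    obtain w where w: "w \<in> S" "(a, y) \<in> w" "(b, f y) \<in> w" using fib[of y] basic_dom[OF r] by auto
    show "(f x, f y) \<in> r"
    proof (cases "thin v \<or> thin w")
      case True
      show ?thesis using thin_triangle[OF v(1) w(1) r(1) True v(2) w(2) r(2) v(3) w(3)] .
    next
      case False
      then have vw: "nonthin v" "nonthin w" using thin_or_nonthin v w by auto
      show ?thesis
      proof (cases "v\<inverse> O w \<in> S")
        case True
        show ?thesis using in_product_basic[OF True r(1) v(2) w(2) r(2) v(3) w(3)] .
      next
        case False
        have "(x, y) \<in> v\<inverse> O w" using v w by auto
        then have "r \<subseteq> v\<inverse> O w"
          using saturatedD r saturated_comp saturated_basic saturated_converse v w by metis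
        then have "thin r"
          using perp_eq_all_thin[OF vw _ False _ r(1)] perp vw z by simp
        \<comment> \<open>The choice depends only on the set \<open>T x\<close>, so points of one
          orbit get literally the same representative.\<close>
        then have "rep x = rep y" using T_eq[of r x y] r unfolding rep_def by simp
        then show ?thesis using same r by simp
      qed
    qed
  qed
  moreover have "f a = b"
  proof -
    obtain v where v: "v \<in> S" "(a, a) \<in> v" "(b, f a) \<in> v" using fib assms(4) by metis
    have "(a, a) \<in> Id_on \<Omega>" using assms(4) by (rule Id_onI)
    then have "v = Id_on \<Omega>" by (rule basic_eq[OF v(1) diagonal_basic v(2)])
    then show ?thesis using v by auto
  qed
  ultimately show ?thesis using that by simp
qed

subsection \<open>Quadruples of points that differ in one relation\<close>

definition tetrahedron ::
    "('a \<times> 'a) set \<Rightarrow> ('a \<times> 'a) set \<Rightarrow> ('a \<times> 'a) set \<Rightarrow> ('a \<times> 'a) set \<Rightarrow> ('a \<times> 'a) set \<Rightarrow>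
     ('a \<times> 'a) set \<Rightarrow> bool" where
  "tetrahedron s v w e f r \<longleftrightarrow> (\<exists>a b x y. (a, b) \<in> s \<and> (a, x) \<in> v \<and> (a, y) \<in> w \<and>
     (b, x) \<in> e \<and> (b, y) \<in> f \<and> (x, y) \<in> r)"

text \<open>This is the obstruction to transporting points, restricted to three pairwise different
  orthogonals. The two quadruples may lie anywhere; the contradiction in
  \<open>no_twisted_base\<close> is for quadruples over consecutive edges of
  \<open>s\<close>.\<close>

definition twisted ::
    "('a \<times> 'a) set \<Rightarrow> ('a \<times> 'a) set \<Rightarrow> ('a \<times> 'a) set \<Rightarrow> ('a \<times> 'a) set \<Rightarrow> ('a \<times> 'a) set \<Rightarrow>
     ('a \<times> 'a) set \<Rightarrow> ('a \<times> 'a) set \<Rightarrow> bool" where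
  "twisted s v w e f r r' \<longleftrightarrow> nonthin s \<and> nonthin v \<and> nonthin w \<and>
     e \<in> S \<and> f \<in> S \<and> r \<in> S \<and> r' \<in> S \<and> r \<noteq> r' \<and>
     perp s \<noteq> perp v \<and> perp s \<noteq> perp w \<and> perp v \<noteq> perp w \<and>
     tetrahedron s v w e f r \<and> tetrahedron s v w e f r'"

lemma twisted_swap: "twisted s v w e f r r' \<Longrightarrow> twisted s v w e f r' r"
  unfolding twisted_def by auto

lemma tetrahedron_mirror: "tetrahedron s v w e f r \<Longrightarrow> tetrahedron s w v f e (r\<inverse>)"
  unfolding tetrahedron_def by blast

lemma twisted_mirror: "twisted s v w e f r r' \<Longrightarrow> twisted s w v f e (r\<inverse>) (r'\<inverse>)"
  unfolding twisted_def using tetrahedron_mirror converse_closed by auto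

lemma perp_neq_product:
  assumes "nonthin v" "nonthin w" "perp v \<noteq> perp w" "r \<in> S" "r \<subseteq> v\<inverse> O w"
  shows "nonthin r" "v\<inverse> O w \<notin> S"
proof -
  show "v\<inverse> O w \<notin> S" using single_product(3)[OF assms(1,2)] assms(3) by auto
  show "nonthin r"
  proof (rule ccontr)
    assume "\<not> nonthin r"
    then have t: "thin r" using thin_or_nonthin assms(4) by auto
    have "w = v O r" using thin_in_product[OF _ _ t assms(5)] assms nonthin_basic by simp
    then show False using perp_comp_thin[OF nonthin_basic[OF assms(1)] t] assms(3) by simp
  qed
qed

text \<open>By \<open>perp_in_difference\<close> all four orthogonals lie in
  \<open>r O r'\<inverse>\<close>, which has at most two constituents; \<open>perp v\<close> and
  \<open>perp w\<close> already are two.\<close>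

lemma perp_in_pair:
  assumes "nonthin v" "nonthin w" "nonthin x" "nonthin y" "perp v \<noteq> perp w"
    and "r \<in> S" "r' \<in> S" "r \<noteq> r'"
    and "r \<subseteq> v\<inverse> O w" "r' \<subseteq> v\<inverse> O w" "r \<subseteq> x\<inverse> O y" "r' \<subseteq> x\<inverse> O y"
  shows "perp x = perp v \<or> perp x = perp w" "perp y = perp v \<or> perp y = perp w"
proof -
  note two = two_basics[OF assms(6) converse_closed[OF assms(7)] perp_basic[OF assms(1)]
      perp_basic[OF assms(2)] _ assms(5) perp_in_difference[OF assms(1,2,6,7,8,9,10)]]
  show "perp x = perp v \<or> perp x = perp w" "perp y = perp v \<or> perp y = perp w"
    using two[OF perp_basic[OF assms(3)]] two[OF perp_basic[OF assms(4)]]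
      perp_in_difference[OF assms(3,4,6,7,8,11,12)] by auto
qed

lemma product_subset:
  assumes "v \<in> S" "w \<in> S" "r \<in> S" "(a, x) \<in> v" "(x, y) \<in> w" "(a, y) \<in> r"
  shows "r \<subseteq> v O w"
  using comp_transfer assms by metis

text \<open>Exchange the vertex in the \<open>v\<close>-neighbourhood of the first vertex for the other point of that
  neighbourhood, in both tetrahedra.\<close>

lemma twisted_other:
  assumes "twisted s v w e f r r'"
  obtains e' where "e' \<noteq> e" "e \<subseteq> s\<inverse> O v" "e' \<subseteq> s\<inverse> O v" "e \<subseteq> f O r\<inverse>" "e' \<subseteq> f O r\<inverse>"
    "twisted s v w e' f r' r"
proof -
  note tw = assms[unfolded twisted_def]
  have n: "nonthin s" "nonthin v" "nonthin w" "perp s \<noteq> perp v" "r \<noteq> r'"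
    and S: "s \<in> S" "v \<in> S" "w \<in> S" "e \<in> S" "f \<in> S" "r \<in> S" "r' \<in> S"
    using tw nonthin_basic by auto
  have C: "s\<inverse> \<in> S" "v\<inverse> \<in> S" "r\<inverse> \<in> S" "r'\<inverse> \<in> S" using converse_closed S by auto
  obtain a b x y where p: "(a, b) \<in> s" "(a, x) \<in> v" "(a, y) \<in> w" "(b, x) \<in> e" "(b, y) \<in> f"
      "(x, y) \<in> r"
    using tw unfolding tetrahedron_def by auto
  obtain A B X Y where P: "(A, B) \<in> s" "(A, X) \<in> v" "(A, Y) \<in> w" "(B, X) \<in> e" "(B, Y) \<in> f"
      "(X, Y) \<in> r'"
    using tw unfolding tetrahedron_def by auto
  have "r' \<subseteq> v\<inverse> O w" "r \<subseteq> v\<inverse> O w"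
    using product_subset[OF C(2) S(3) S(7), of X A Y] product_subset[OF C(2) S(3) S(6), of x a y] p P
    by auto
  then have wv: "r'\<inverse> \<subseteq> w\<inverse> O v" "r\<inverse> \<subseteq> w\<inverse> O v" by auto
  \<comment> \<open>The relation \<open>r'\<close> also occurs over \<open>(a, y)\<close>, and
    \<open>r\<close> over \<open>(A, Y)\<close>; this produces the other points \<open>x'\<close>
    and \<open>Z\<close> of the two \<open>v\<close>-neighbourhoods.\<close>
  obtain x' where x': "(a, x') \<in> v" "(x', y) \<in> r'"
    using product_at[OF S(3,2) C(4) wv(1) p(3)] by auto
  obtain Z where Z: "(A, Z) \<in> v" "(Z, Y) \<in> r" using product_at[OF S(3,2) C(3) wv(2) P(3)] by auto
  have ne: "x' \<noteq> x" "Z \<noteq> X"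
    using basic_eq[OF S(6,7)] n(5) p(6) x'(2) P(6) Z(2) by auto
  obtain e' where e': "e' \<in> S" "(b, x') \<in> e'"
    using basic_ex[of b x'] basic_dom[OF S(1) p(1)] basic_dom[OF S(2) x'(1)] by metis
  have sub: "e \<subseteq> s\<inverse> O v" "e' \<subseteq> s\<inverse> O v"
    using product_subset[OF C(1) S(2) S(4), of b a x] product_subset[OF C(1) S(2) e'(1), of b a x']
      p x' e' by auto
  \<comment> \<open>Equality would make \<open>s\<inverse> O v\<close> basic, against the different
    orthogonals of \<open>s\<close> and \<open>v\<close>.\<close>
  have "e' \<noteq> e"
    using product_eq_basic[OF S(1,2,4) p(1,2) x'(1) ne(1)[symmetric] p(4)] e'(2)
      perp_neq_product(2)[OF n(1,2,4) S(4) sub(1)] S(4) by auto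
  obtain X' where X': "(A, X') \<in> v" "(B, X') \<in> e'"
    using product_at[OF S(1,2) e'(1) sub(2) P(1)] by auto
  have "X' \<noteq> X" using basic_eq[OF S(4) e'(1)] P(4) X'(2) \<open>e' \<noteq> e\<close> by auto
  then have "X' = Z" using image_two[OF S(2) P(2) Z(1) _ X'(1)] ne by auto
  have "e \<subseteq> f O r\<inverse>" "e' \<subseteq> f O r\<inverse>"
    using product_subset[OF S(5) C(3) S(4), of b y x] product_subset[OF S(5) C(3) e'(1), of B Y X']
      p P X' Z \<open>X' = Z\<close> by auto
  moreover have "tetrahedron s v w e' f r'" "tetrahedron s v w e' f r"
    unfolding tetrahedron_def using p P x' X' e' Z \<open>X' = Z\<close> by blast+
  then have "twisted s v w e' f r' r" using tw e' unfolding twisted_def by auto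
  ultimately show ?thesis using that \<open>e' \<noteq> e\<close> sub by simp
qed

lemma twisted_subset:
  assumes "twisted s v w e f r r'"
  shows "r \<subseteq> v\<inverse> O w" "r \<subseteq> e\<inverse> O f"
proof -
  have S: "v\<inverse> \<in> S" "w \<in> S" "e\<inverse> \<in> S" "f \<in> S" "r \<in> S"
    using assms nonthin_basic converse_closed unfolding twisted_def by auto
  obtain a b x y where p: "(a, b) \<in> s" "(a, x) \<in> v" "(a, y) \<in> w" "(b, x) \<in> e" "(b, y) \<in> f"
      "(x, y) \<in> r"
    using assms unfolding twisted_def tetrahedron_def by auto
  then show "r \<subseteq> v\<inverse> O w" "r \<subseteq> e\<inverse> O f"
    using product_subset[OF S(1,2,5), of x a y] product_subset[OF S(3,4,5), of x b y] by auto
qed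

text \<open>Each of \<open>r\<close>, \<open>e\<close>, \<open>f\<close> has a partner lying with it
  in two products. So \<open>perp_in_pair\<close> puts \<open>perp e\<close>, \<open>perp f\<close>
  among those of \<open>v\<close>, \<open>w\<close>; \<open>perp f\<close>, \<open>perp r\<close>
  among those of \<open>s\<close>, \<open>v\<close>; and \<open>perp e\<close>,
  \<open>perp r\<close> among those of \<open>s\<close>, \<open>w\<close>. Only one assignment
  remains.\<close>

lemma twisted_perp:
  assumes "twisted s v w e f r r'"
  shows "nonthin e" "nonthin f" "nonthin r" "perp e = perp w" "perp f = perp v" "perp r = perp s"
proof -
  note tw = assms[unfolded twisted_def]
  have n: "nonthin s" "nonthin v" "nonthin w" "perp s \<noteq> perp v" "perp s \<noteq> perp w"
      "perp v \<noteq> perp w" "r \<noteq> r'"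
    and S: "e \<in> S" "f \<in> S" "r \<in> S" "r' \<in> S" "r\<inverse> \<in> S"
    using tw converse_closed by auto
  obtain e' where e': "e' \<noteq> e" "e \<subseteq> s\<inverse> O v" "e' \<subseteq> s\<inverse> O v" "e \<subseteq> f O r\<inverse>" "e' \<subseteq> f O r\<inverse>"
      "twisted s v w e' f r' r"
    using twisted_other[OF assms] by metis
  obtain f' where f': "f' \<noteq> f" "f \<subseteq> s\<inverse> O w" "f' \<subseteq> s\<inverse> O w" "f \<subseteq> e O r" "f' \<subseteq> e O r"
      "twisted s w v f' e (r'\<inverse>) (r\<inverse>)"
    using twisted_other[OF twisted_mirror[OF assms]] by auto
  have S': "e' \<in> S" "f' \<in> S" using e'(6) f'(6) unfolding twisted_def by auto
  note sub = twisted_subset[OF assms] twisted_subset[OF twisted_swap[OF assms]]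
  show ne: "nonthin e" using perp_neq_product(1)[OF n(1,2,4) S(1) e'(2)] .
  show nf: "nonthin f" using perp_neq_product(1)[OF n(1,3,5) S(2) f'(2)] .
  show nr: "nonthin r" using perp_neq_product(1)[OF n(2,3,6) S(3) sub(1)] .
  have c: "perp (e\<inverse>) = perp e" "perp (f\<inverse>) = perp f" "perp (r\<inverse>) = perp r"
    using perp_converse S by auto
  note pr = perp_in_pair[OF n(2,3) ne nf n(6) S(3,4) n(7) sub(1,3,2,4)]
  note pe = perp_in_pair[OF n(1,2) nonthin_converse[OF nf] nonthin_converse[OF nr] n(4) S(1) S'(1)
      e'(1)[symmetric] e'(2,3), simplified c converse_converse, OF e'(4,5)]
  note pf = perp_in_pair[OF n(1,3) nonthin_converse[OF ne] nr n(5) S(2) S'(2)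
      f'(1)[symmetric] f'(2,3), simplified c converse_converse, OF f'(4,5)]
  show "perp e = perp w" "perp f = perp v" "perp r = perp s"
    using pr pe pf n(4-6) by metis+
qed

text \<open>The product \<open>e O e'\<inverse>\<close> contains both \<open>perp s\<close> and
  \<open>perp v\<close>, and by \<open>perp_eq_cases\<close> a thin relation, which must be one of
  them. Calling it \<open>p\<close>, the product equals \<open>p \<union> perp e O p\<close>, so the
  other one is \<open>perp e O p\<close>.\<close>

lemma equal_perp_difference:
  assumes "nonthin s" "nonthin v" "perp s \<noteq> perp v" "nonthin e" "nonthin e'" "e \<noteq> e'"
    and "perp e = perp e'" "e \<subseteq> s\<inverse> O v" "e' \<subseteq> s\<inverse> O v"
  shows "thin (perp s) \<or> thin (perp v)" "perp e = perp s O perp v"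
proof -
  have S: "e \<in> S" "e' \<in> S" "e\<inverse> \<in> S" "e'\<inverse> \<in> S" using assms nonthin_basic converse_closed by auto
  have P: "perp s \<in> S" "perp v \<in> S" using perp_basic assms by auto
  have p: "perp s \<subseteq> e O e'\<inverse>" "perp v \<subseteq> e O e'\<inverse>"
    using perp_in_difference[OF assms(1,2) S(1,2) assms(6,8,9)] .
  have n: "nonthin (e\<inverse>)" "nonthin (e'\<inverse>)" "perp (e\<inverse>) = perp (e'\<inverse>)"
    using nonthin_converse assms perp_converse S by auto
  have "e O e'\<inverse> \<notin> S" using basic_subset_eq[OF P(1) _ p(1)] basic_subset_eq[OF P(2) _ p(2)] assms(3) by metis
  then obtain t where t: "thin t" "t \<subseteq> e O e'\<inverse>" using perp_eq_cases[OF n] by auto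
  then have "t = perp s \<or> t = perp v"
    using two_basics[OF S(1,4) P thin_basic assms(3) p] by auto
  then show th: "thin (perp s) \<or> thin (perp v)" using t by auto
  have *: "perp e = q O p" if pq: "thin p" "p\<inverse> = p" "p \<subseteq> e O e'\<inverse>" "q \<subseteq> e O e'\<inverse>" "q \<in> S" "q \<noteq> p" for p q
  proof -
    have "e'\<inverse> = e\<inverse> O p" using thin_in_product[OF S(3,4) pq(1)] pq(3) by simp
    then have "e O e'\<inverse> = (e\<inverse>)\<inverse> O (e\<inverse> O p)" by simp
    also have "\<dots> = p \<union> perp e O p"
      unfolding converse_comp_thin_multiple[OF S(3)] perp_converse[OF S(1)]
      using diagonal_comp(1)[OF saturated_basic[OF thin_basic[OF pq(1)]]] by simp
    finally have "q \<subseteq> p \<union> perp e O p" using pq(4) by simp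
    moreover have "perp e O p \<in> S" using comp_thin_basic perp_basic assms(4) pq(1) by simp
    ultimately have "q = perp e O p" using basic_in_union pq(1,5,6) thin_basic by metis
    then show ?thesis
      using comp_thin_cancel(1)[OF saturated_basic[OF perp_basic[OF assms(4)]] pq(1)] pq(2) by simp
  qed
  show "perp e = perp s O perp v"
    using th *[of "perp s" "perp v"] *[of "perp v" "perp s"] p P assms(3) perp_sym
      basic_commute[OF P] by auto
qed

text \<open>Applied to the pairs \<open>e\<close>, \<open>e'\<close> and \<open>f\<close>,
  \<open>f'\<close> and \<open>r\<close>, \<open>r'\<close>, the preceding lemma makes each
  orthogonal the product of the other two, and one of any two thin. So two are thin, and their
  product is too.\<close>

lemma twisted_thin:
  assumes "twisted s v w e f r r'"
  shows "thin (perp s)" "thin (perp v)" "thin (perp w)" "perp w = perp s O perp v"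
proof -
  note tw = assms[unfolded twisted_def]
  have n: "nonthin s" "nonthin v" "nonthin w" "perp s \<noteq> perp v" "perp s \<noteq> perp w"
      "perp v \<noteq> perp w" "r \<noteq> r'"
    using tw by auto
  obtain e' where e': "e' \<noteq> e" "e \<subseteq> s\<inverse> O v" "e' \<subseteq> s\<inverse> O v" "twisted s v w e' f r' r"
    using twisted_other[OF assms] by metis
  obtain f' where f': "f' \<noteq> f" "f \<subseteq> s\<inverse> O w" "f' \<subseteq> s\<inverse> O w" "twisted s w v f' e (r'\<inverse>) (r\<inverse>)"
    using twisted_other[OF twisted_mirror[OF assms]] by metis
  note a = twisted_perp[OF assms] and b = twisted_perp[OF twisted_swap[OF assms]]
    and ae = twisted_perp[OF e'(4)] and af = twisted_perp[OF f'(4)]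
    and sub = twisted_subset(1)[OF assms] twisted_subset(1)[OF twisted_swap[OF assms]]
  have 1: "thin (perp s) \<or> thin (perp v)" "perp w = perp s O perp v"
    using equal_perp_difference[OF n(1,2,4) a(1) ae(1) e'(1)[symmetric] _ e'(2,3)] a(4) ae(4) by auto
  have 2: "thin (perp s) \<or> thin (perp w)" "perp v = perp s O perp w"
    using equal_perp_difference[OF n(1,3,5) a(2) af(1) f'(1)[symmetric] _ f'(2,3)] a(5) af(4) by auto
  have 3: "thin (perp v) \<or> thin (perp w)" "perp s = perp v O perp w"
    using equal_perp_difference[OF n(2,3,6) a(3) b(3) n(7) _ sub] a(6) b(6) by auto
  show "thin (perp s)" "thin (perp v)" "thin (perp w)" "perp w = perp s O perp v"
    using 1 2 3 thin_comp by metis+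
qed

section \<open>Excluding twisted quadruples over consecutive edges\<close>

lemma thin_stabilizer:
  assumes "nonthin w" "thin d" "w O d = w"
  shows "d = Id_on \<Omega> \<or> d = perp w"
proof -
  have w: "w \<in> S" using assms nonthin_basic by simp
  have "Id_on \<Omega> O d \<subseteq> w\<inverse> O (w O d)" unfolding converse_comp_thin_multiple[OF w] by auto
  then have "d \<subseteq> Id_on \<Omega> \<union> perp w"
    using assms(3) converse_comp_self[OF w] diagonal_comp(1)[OF saturated_basic[OF thin_basic[OF assms(2)]]]
    by simp
  then show ?thesis using basic_in_union thin_basic assms(1,2) diagonal_basic perp_basic by metis
qed

lemma thin_commute: "thin t \<Longrightarrow> thin q \<Longrightarrow> t O q = q O t"
  using basic_commute thin_basic by simp

lemma involution_comp:
  assumes "thin t" "t O t = Id_on \<Omega>" "thin q" "q O q = Id_on \<Omega>"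
  shows "thin (t O q) \<and> (t O q) O (t O q) = Id_on \<Omega>"
proof -
  have "(t O q) O (t O q) = t O ((q O t) O q)" by auto
  also have "\<dots> = t O ((t O q) O q)" using thin_commute assms by simp
  also have "\<dots> = (t O t) O (q O q)" by auto
  also have "\<dots> = Id_on \<Omega>" using assms by auto
  finally show ?thesis using thin_comp assms by simp
qed

text \<open>All thin relations occurring here commute, so the two ways of going round the pair of
  tetrahedra \<open>a b x y\<close> and \<open>b c X Y\<close> compare \<open>r\<close> and \<open>r'\<close>: they differ by the square of a
  thin relation in the group generated by the three involutions \<open>perp s\<close>, \<open>perp v\<close>, \<open>perp w\<close>.\<close>

lemma no_twisted_base:
  assumes "nonthin s" "nonthin v" "nonthin w"
    and "perp s \<noteq> perp v" "perp s \<noteq> perp w" "perp v \<noteq> perp w"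
    and "e \<in> S" "f \<in> S" "r \<in> S" "r' \<in> S" "r \<noteq> r'"
    and p: "(a, b) \<in> s" "(a, x) \<in> v" "(a, y) \<in> w" "(b, x) \<in> e" "(b, y) \<in> f" "(x, y) \<in> r"
    and P: "(b, c) \<in> s" "(b, X) \<in> v" "(b, Y) \<in> w" "(c, X) \<in> e" "(c, Y) \<in> f" "(X, Y) \<in> r'"
  shows False
proof -
  have tw: "twisted s v w e f r r'"
    unfolding twisted_def tetrahedron_def using assms by blast
  note perps = twisted_perp[OF tw] and th = twisted_thin[OF tw]
  have S: "s \<in> S" "v \<in> S" "w \<in> S" and C: "s\<inverse> \<in> S" "v\<inverse> \<in> S" "w\<inverse> \<in> S"
    using assms nonthin_basic converse_closed by auto
  \<comment> \<open>A basic product would leave only one orthogonal, but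
    \<open>perp s \<noteq> perp v\<close>.\<close>
  have no_single: "g\<inverse> O h \<notin> S" if "nonthin g" "nonthin h" for g h
    using single_product_unique_perp[OF that, of s] single_product_unique_perp[OF that, of v]
      assms(1,2,4) by auto
  have thin_quotient: "\<exists>t. thin t \<and> (z, z') \<in> t"
    if g: "nonthin g" "nonthin h" "perp g = perp h" "thin (perp g)" "(k, z) \<in> g" "(k, z') \<in> h"
    for g h k z z'
  proof -
    have gS: "g \<in> S" "h \<in> S" "g\<inverse> \<in> S" using g nonthin_basic converse_closed by auto
    obtain t where t: "t \<in> S" "(z, z') \<in> t" using basic_ex basic_dom gS g by metis
    have "t \<subseteq> g\<inverse> O h" using product_subset[OF gS(3,2) t(1)] g t by auto
    then show ?thesis
      using perp_eq_all_thin[OF g(1-3) no_single[OF g(1,2)] g(4) t(1)] t(2) by auto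
  qed
  \<comment> \<open>Both ends are seen from the common vertex \<open>b\<close> by relations with
    equal thin orthogonals; the same holds for \<open>t2\<close> and \<open>t3\<close>.\<close>
  obtain t1 where t1: "thin t1" "(c, a) \<in> t1"
    using thin_quotient[OF assms(1) nonthin_converse[OF assms(1)] _ th(1) P(1)] p(1)
      perp_converse[OF S(1)] by auto
  obtain t2 where t2: "thin t2" "(Y, x) \<in> t2"
    using thin_quotient[OF assms(3) perps(1) _ th(3) P(3) p(4)] perps(4) by auto
  obtain t3 where t3: "thin t3" "(X, y) \<in> t3"
    using thin_quotient[OF assms(2) perps(2) _ th(2) P(2) p(5)] perps(5) by auto
  obtain t where t: "thin t" "t \<subseteq> s\<inverse> O r"
    using perp_eq_cases[OF assms(1) perps(3) _ no_single[OF assms(1) perps(3)]] perps(6) by auto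
  have T: "t1 \<in> S" "t2 \<in> S" "t3 \<in> S" "t \<in> S" "t\<inverse> \<in> S"
    using thin_basic thin_converse t t1 t2 t3 by auto
  note sat = S[THEN saturated_basic] C[THEN saturated_basic] T[THEN saturated_basic]
    assms(7-10)[THEN saturated_basic]
  have eq: "u O q = u' O q'"
    if "u O q \<in> S" "u' O q' \<in> S" "(g, h) \<in> u" "(h, k) \<in> q" "(g, h') \<in> u'" "(h', k) \<in> q'"
    for u q u' q' g h h' k
    using basic_eq[OF that(1,2), of g k] that(3-6) by auto
  \<comment> \<open>Each of the next six equations compares two routes between the same two
    vertices, for instance from \<open>b\<close> to \<open>x\<close> through \<open>Y\<close> and
    directly.\<close>
  have we: "w O t2 = e"
    using basic_eq[OF comp_thin_basic[OF S(3) t2(1)] assms(7) _ p(4)] P(3) t2(2) by auto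
  have vf: "v O t3 = f"
    using basic_eq[OF comp_thin_basic[OF S(2) t3(1)] assms(8) _ p(5)] P(2) t3(2) by auto
  have st: "s O t1 = s\<inverse>"
    using basic_eq[OF comp_thin_basic[OF S(1) t1(1)] C(1), of b a] P(1) p(1) t1(2) by auto
  have et: "e O t3 = t1 O w"
    using eq[OF comp_thin_basic[OF assms(7) t3(1)] thin_comp_basic[OF S(3) t1(1)] P(4) t3(2) t1(2) p(3)] .
  have ft: "f O t2 = t1 O v"
    using eq[OF comp_thin_basic[OF assms(8) t2(1)] thin_comp_basic[OF S(2) t1(1)] P(5) t2(2) t1(2) p(2)] .
  have rt: "r' O t2 = t3 O r\<inverse>"
    using eq[OF comp_thin_basic[OF assms(10) t2(1)]
        thin_comp_basic[OF converse_closed[OF assms(9)] t3(1)] P(6) t2(2) t3(2)] p(6) by simp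
  have r: "r = s O t" using thin_in_product[OF S(1) assms(9) t] .
  \<comment> \<open>\<open>d\<close> measures the failure of \<open>t2 O t3 = t1\<close>. It
    stabilises both \<open>w\<close> and \<open>v\<close>, so it is trivial because
    \<open>perp v \<noteq> perp w\<close>.\<close>
  define d where "d = (t2 O t3) O t1\<inverse>"
  have d: "thin d" using d_def thin_comp thin_converse t1 t2 t3 by simp
  have "w O (t2 O t3) = w O t1" using et we saturated_commute[OF sat(3,7)] by (simp flip: O_assoc)
  then have "w O d = w"
    unfolding d_def using comp_thin_cancel(1)[OF sat(3) t1(1)] by (metis O_assoc)
  moreover have "v O (t2 O t3) = v O t1"
    using ft vf saturated_commute[OF sat(2,7)] thin_commute[OF t2(1) t3(1)] by (simp flip: O_assoc)
  then have "v O d = v"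
    unfolding d_def using comp_thin_cancel(1)[OF sat(2) t1(1)] by (metis O_assoc)
  ultimately have "d = Id_on \<Omega>"
    using thin_stabilizer[OF assms(3) d] thin_stabilizer[OF assms(2) d] assms(6) by auto
  then have t123: "t2 O t3 = t1"
    using comp_thin_cancel(2)[OF saturated_comp[OF sat(8,9)] t1(1)] diagonal_comp(1)[OF sat(7)] d_def
    by simp
  \<comment> \<open>With \<open>r = s O t\<close>, the quotient \<open>m\<close> satisfies
    \<open>r O m = s O t3\<close>; the equation \<open>rt\<close> then turns into
    \<open>r' = r O (m O m)\<close>.\<close>
  define m where "m = t3 O t\<inverse>"
  have m: "thin m" using m_def thin_comp thin_converse t t3 by simp
  have "(s O t) O (t3 O t\<inverse>) = ((s O t3) O t) O t\<inverse>"
    using thin_commute[OF t(1) t3(1)] by (metis O_assoc)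
  then have rm: "r O m = s O t3"
    using r m_def comp_thin_cancel(1)[OF saturated_comp[OF sat(1,9)] t(1)] by simp
  have "r\<inverse> = t\<inverse> O (s O (t2 O t3))" using r st t123 by (simp add: converse_relcomp)
  then have "r' O t2 = t3 O (t\<inverse> O (s O (t2 O t3)))" using rt by simp
  also have "\<dots> = ((s O t3) O (t3 O t\<inverse>)) O t2"
    by (simp add: O_assoc saturated_commute saturated_left_commute sat)
  also have "\<dots> = ((r O m) O m) O t2" unfolding rm by (simp add: m_def)
  also have "\<dots> = (r O (m O m)) O t2" by (simp add: O_assoc)
  finally have "(r' O t2) O t2\<inverse> = ((r O (m O m)) O t2) O t2\<inverse>" by simp
  then have rr: "r' = r O (m O m)"
    using comp_thin_cancel(1)[OF sat(15) t2(1)]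
      comp_thin_cancel(1)[OF saturated_basic[OF comp_thin_basic[OF assms(9) thin_comp[OF m m]]] t2(1)]
    by simp
  \<comment> \<open>Bounding \<open>t3\<close> and \<open>t\<close> by products of
    \<open>s\<inverse>\<close>, \<open>v\<inverse>\<close>, \<open>w\<close> confines
    \<open>m\<close> to products of the diagonal or \<open>perp w\<close>, the diagonal or
    \<open>perp v\<close>, and the diagonal or \<open>perp s\<close>. Hence \<open>m O m\<close> is
    the diagonal.\<close>
  have "f \<subseteq> s\<inverse> O w" "t3 \<subseteq> v\<inverse> O f" "r \<subseteq> v\<inverse> O w"
    using product_subset[OF C(1) S(3) assms(8), of c b Y] product_subset[OF C(2) assms(8) T(3), of X b y]
      product_subset[OF C(2) S(3) assms(9), of x a y] p P t3 by auto
  then have "t3 \<subseteq> v\<inverse> O (s\<inverse> O w)" "t \<subseteq> s\<inverse> O (v\<inverse> O w)" using t(2) by blast+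
  then have "m \<subseteq> (v\<inverse> O (s\<inverse> O w)) O (s\<inverse> O (v\<inverse> O w))\<inverse>" unfolding m_def by blast
  also have "\<dots> = (w O w\<inverse>) O ((v\<inverse> O v) O (s\<inverse> O s))"
    by (simp add: converse_relcomp O_assoc saturated_commute saturated_left_commute sat)
  also have "\<dots> = (Id_on \<Omega> \<union> perp w) O ((Id_on \<Omega> \<union> perp v) O (Id_on \<Omega> \<union> perp s))"
    using comp_converse_self converse_comp_self S by simp
  finally have mm: "m \<subseteq> (Id_on \<Omega> \<union> perp w) O ((Id_on \<Omega> \<union> perp v) O (Id_on \<Omega> \<union> perp s))" .
  obtain g0 g3 where g: "(g0, g3) \<in> m" using basic_nonempty thin_basic[OF m] by metis
  then obtain g1 g2 where g123: "(g0, g1) \<in> Id_on \<Omega> \<union> perp w" "(g1, g2) \<in> Id_on \<Omega> \<union> perp v"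
      "(g2, g3) \<in> Id_on \<Omega> \<union> perp s"
    using mm by blast
  have inv: "\<exists>q. thin q \<and> q O q = Id_on \<Omega> \<and> (h, k) \<in> q"
    if "(h, k) \<in> Id_on \<Omega> \<union> perp u" "thin (perp u)" for h k u
  proof (cases "(h, k) \<in> perp u")
    case True
    then show ?thesis using that(2) perp_thin_square by auto
  next
    case False
    then have "(h, k) \<in> Id_on \<Omega>" using that(1) by auto
    moreover have "Id_on \<Omega> O Id_on \<Omega> = Id_on \<Omega>" by auto
    ultimately show ?thesis using thin_diagonal by metis
  qed
  obtain q1 q2 q3 where q: "thin q1" "q1 O q1 = Id_on \<Omega>" "(g0, g1) \<in> q1"
      "thin q2" "q2 O q2 = Id_on \<Omega>" "(g1, g2) \<in> q2"
      "thin q3" "q3 O q3 = Id_on \<Omega>" "(g2, g3) \<in> q3"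
    using inv[OF g123(1) th(3)] inv[OF g123(2) th(2)] inv[OF g123(3) th(1)] by metis
  note q23 = involution_comp[OF q(4,5) q(7,8)]
  have q123: "thin (q1 O (q2 O q3))" "(q1 O (q2 O q3)) O (q1 O (q2 O q3)) = Id_on \<Omega>"
    using involution_comp[OF q(1,2), of "q2 O q3"] q23 by auto
  have "m = q1 O (q2 O q3)"
    using basic_eq[OF thin_basic[OF m] thin_basic[OF q123(1)] g] q(3,6,9) by auto
  then have "r' = r" using rr q123(2) diagonal_comp(2)[OF sat(14)] by simp
  then show False using assms(11) by simp
qed

section \<open>Transport of points along a base edge without basic products\<close>

lemma base_unique:
  assumes "s \<in> S" "\<And>v. nonthin v \<Longrightarrow> s\<inverse> O v \<notin> S" "v \<in> S" "e \<in> S"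
    and "(a, b) \<in> s" "(a, x) \<in> v" "(a, x') \<in> v" "(b, x) \<in> e" "(b, x') \<in> e"
  shows "x = x'"
proof (rule ccontr)
  assume ne: "x \<noteq> x'"
  then have "nonthin v" using assms unfolding nonthin_def single_valued_def by auto
  moreover have "s\<inverse> O v = e" using product_eq_basic[OF assms(1,3,4,5,6,7) ne assms(8,9)] .
  ultimately show False using assms(2)[of v] assms(4) by simp
qed

text \<open>If the orthogonals agreed, a thin \<open>t\<close> in \<open>s\<inverse> O v\<close>
  would join \<open>b\<close> and \<open>B\<close> to the other points \<open>x'\<close>,
  \<open>X'\<close> of the \<open>v\<close>-neighbourhoods. There \<open>(x', y)\<close> is in
  \<open>r'\<close> and \<open>(X', Y)\<close> in \<open>r\<close>, but \<open>t\<close> and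
  \<open>f\<close> determine this relation by \<open>thin_triangle\<close>.\<close>

lemma perp_neq_edge:
  assumes "nonthin s" "nonthin v" "s\<inverse> O v \<notin> S" "nonthin e"
    and S: "w \<in> S" "f \<in> S" "r \<in> S" "r' \<in> S" "r \<noteq> r'"
    and p: "(a, b) \<in> s" "(a, x) \<in> v" "(a, y) \<in> w" "(b, x) \<in> e" "(b, y) \<in> f" "(x, y) \<in> r"
    and P: "(A, B) \<in> s" "(A, X) \<in> v" "(A, Y) \<in> w" "(B, X) \<in> e" "(B, Y) \<in> f" "(X, Y) \<in> r'"
  shows "perp s \<noteq> perp v"
proof
  assume "perp s = perp v"
  then obtain t where t: "thin t" "t \<subseteq> s\<inverse> O v" using perp_eq_cases[OF assms(1,2) _ assms(3)] by metis
  have sv: "s \<in> S" "v \<in> S" "e \<in> S" and tS: "t \<in> S" using assms nonthin_basic thin_basic t by auto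
  have C: "v\<inverse> \<in> S" "r\<inverse> \<in> S" "r'\<inverse> \<in> S" using sv S converse_closed by auto
  obtain x' where x': "(a, x') \<in> v" "(b, x') \<in> t" using product_at[OF sv(1,2) tS t(2) p(1)] by metis
  obtain X' where X': "(A, X') \<in> v" "(B, X') \<in> t" using product_at[OF sv(1,2) tS t(2) P(1)] by metis
  have "t \<noteq> e" using assms(4) t(1) thin_not_nonthin by auto
  then have ne: "x' \<noteq> x" "X' \<noteq> X" using basic_eq[OF tS sv(3)] x' X' p P by auto
  have sub: "r'\<inverse> \<subseteq> w\<inverse> O v" "r\<inverse> \<subseteq> w\<inverse> O v"
    using product_subset[OF C(1) S(1) S(4), of X A Y] product_subset[OF C(1) S(1) S(3), of x a y] p P
    by auto
  obtain z where z: "(a, z) \<in> v" "(z, y) \<in> r'" using product_at[OF S(1) sv(2) C(3) sub(1) p(3)] by auto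
  obtain Z where Z: "(A, Z) \<in> v" "(Z, Y) \<in> r" using product_at[OF S(1) sv(2) C(2) sub(2) P(3)] by auto
  have "z \<noteq> x" "Z \<noteq> X" using basic_eq[OF S(3,4)] S(5) z Z p P by auto
  then have "z = x'" "Z = X'"
    using image_two[OF sv(2) p(2) x'(1) _ z(1)] image_two[OF sv(2) P(2) X'(1) _ Z(1)] ne by auto
  then have "(Z, Y) \<in> r'"
    using thin_triangle[OF tS S(2) S(4) _ x'(2) p(5) _ X'(2) P(5)] t(1) z(2) by simp
  then show False using basic_eq[OF S(3,4) Z(2)] S(5) by simp
qed

text \<open>Suppose \<open>(X, Y)\<close> lies in \<open>r' \<noteq> r\<close>. Thin sides are
  excluded by \<open>thin_triangle\<close>, thin \<open>r\<close> or \<open>r'\<close> by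
  \<open>base_unique\<close>, and equal orthogonals by \<open>perp_neq_edge\<close> and
  \<open>perp_eq_cases\<close>; what is left is ruled out by \<open>no_twisted_base\<close>.\<close>

lemma base_rigid:
  assumes "nonthin s" and H: "\<And>v. nonthin v \<Longrightarrow> s\<inverse> O v \<notin> S"
    and S: "v \<in> S" "w \<in> S" "e \<in> S" "f \<in> S" "r \<in> S"
    and p: "(a, b) \<in> s" "(a, x) \<in> v" "(a, y) \<in> w" "(b, x) \<in> e" "(b, y) \<in> f" "(x, y) \<in> r"
    and P: "(b, c) \<in> s" "(b, X) \<in> v" "(b, Y) \<in> w" "(c, X) \<in> e" "(c, Y) \<in> f"
  shows "(X, Y) \<in> r"
proof (rule ccontr)
  assume n: "(X, Y) \<notin> r"
  obtain r' where r': "r' \<in> S" "(X, Y) \<in> r'"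
    using basic_ex[of X Y] basic_dom[OF S(1) P(2)] basic_dom[OF S(2) P(3)] by metis
  have ne: "r \<noteq> r'" using n r' by auto
  have sS: "s \<in> S" using assms nonthin_basic by simp
  have nt: "nonthin v" "nonthin w" "nonthin e" "nonthin f"
    using thin_triangle[OF S(1,2,5) _ p(2,3,6) P(2,3)] thin_triangle[OF S(3,4,5) _ p(4,5,6) P(4,5)]
      n thin_or_nonthin S by auto
  have C: "v\<inverse> \<in> S" "e\<inverse> \<in> S" "r\<inverse> \<in> S" "r'\<inverse> \<in> S" using S r' converse_closed by auto
  have sub: "r \<subseteq> v\<inverse> O w" "r' \<subseteq> v\<inverse> O w" "r \<subseteq> e\<inverse> O f" "r' \<subseteq> e\<inverse> O f"
    using product_subset[OF C(1) S(2) S(5), of x a y] product_subset[OF C(1) S(2) r'(1), of X b Y]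
      product_subset[OF C(2) S(4) S(5), of x b y] product_subset[OF C(2) S(4) r'(1), of X c Y]
      p P r' by auto
  have vw: "v\<inverse> O w \<notin> S"
    using basic_subset_eq[OF S(5) _ sub(1)] basic_subset_eq[OF r'(1) _ sub(2)] ne by metis
  note unique = base_unique[OF sS H]
  have "\<not> thin r"
  proof
    assume t: "thin r"
    \<comment> \<open>The \<open>r\<close>-neighbour of \<open>X\<close> then has the same relations
      to \<open>b\<close> and \<open>c\<close> as \<open>Y\<close>, so it is \<open>Y\<close>. For a
      thin \<open>r'\<close> the argument runs at \<open>x\<close> over the edge from
      \<open>a\<close> to \<open>b\<close>.\<close>
    have eq: "w = v O r" "f = e O r"
      using thin_in_product[OF S(1,2) t sub(1)] thin_in_product[OF S(3,4) t sub(3)] by auto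
    obtain Y' where Y': "(X, Y') \<in> r" using basic_total S(5) basic_dom[OF S(1) P(2)] by metis
    then have "(b, Y') \<in> w" "(c, Y') \<in> f" unfolding eq using P by auto
    then show False using unique[OF _ S(2,4) P(1,3) _ P(5), of Y'] Y' n by auto
  qed
  moreover have "\<not> thin r'"
  proof
    assume t: "thin r'"
    have eq: "w = v O r'" "f = e O r'"
      using thin_in_product[OF S(1,2) t sub(2)] thin_in_product[OF S(3,4) t sub(4)] by auto
    obtain y' where y': "(x, y') \<in> r'" using basic_total r'(1) basic_dom[OF S(1) p(2)] by metis
    then have "(a, y') \<in> w" "(b, y') \<in> f" unfolding eq using p by auto
    then have "y' = y" using unique[OF _ S(2,4) p(1) _ p(3) _ p(5), of y'] by auto
    then show False using basic_eq[OF S(5) r'(1) p(6)] y' ne by simp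
  qed
  ultimately have pvw: "perp v \<noteq> perp w"
    using perp_eq_cases[OF nt(1,2) _ vw] two_basics[OF C(1) S(2,5) r'(1) thin_basic ne sub(1,2)] by metis
  have psv: "perp s \<noteq> perp v"
    using perp_neq_edge[OF assms(1) nt(1) H[OF nt(1)] nt(3) S(2,4,5) r'(1) ne p P r'(2)] .
  have psw: "perp s \<noteq> perp w"
    using perp_neq_edge[OF assms(1) nt(2) H[OF nt(2)] nt(4) S(1,3) C(3,4) _ p(1,3,2,5,4) _ P(1,3,2,5,4)]
      p(6) r'(2) ne by simp
  show False
    using no_twisted_base[OF assms(1) nt(1,2) psv psw pvw S(3,4,5) r'(1) ne p P r'(2)] .
qed

text \<open>The image of \<open>x\<close> is a point seen from \<open>b\<close> and \<open>c\<close>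
  as \<open>x\<close> is seen from \<open>a\<close> and \<open>b\<close>; it exists by
  \<open>product_at\<close>, and \<open>base_rigid\<close> shows that relations are
  preserved.\<close>

lemma transitive_nonthin:
  assumes "nonthin s" "\<And>v. nonthin v \<Longrightarrow> s\<inverse> O v \<notin> S" "(a, b) \<in> s"
  obtains f where "automorphism f" "f a = b"
proof -
  have sS: "s \<in> S" using assms nonthin_basic by simp
  have ab: "a \<in> \<Omega>" "b \<in> \<Omega>" using basic_dom[OF sS assms(3)] by auto
  obtain c where c: "(b, c) \<in> s" using basic_total[OF sS ab(2)] by metis
  define f where "f x = (SOME X. \<exists>v\<in>S. \<exists>e\<in>S. (a, x) \<in> v \<and> (b, X) \<in> v \<and> (b, x) \<in> e \<and> (c, X) \<in> e)"
    for x
  have f: "\<exists>v\<in>S. \<exists>e\<in>S. (a, x) \<in> v \<and> (b, f x) \<in> v \<and> (b, x) \<in> e \<and> (c, f x) \<in> e"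
    if x: "x \<in> \<Omega>" for x
  proof -
    obtain v where v: "v \<in> S" "(a, x) \<in> v" using basic_ex ab x by metis
    obtain e where e: "e \<in> S" "(b, x) \<in> e" using basic_ex ab x by metis
    have "e \<subseteq> s\<inverse> O v"
      using product_subset[OF converse_closed[OF sS] v(1) e(1), of b a x] assms(3) v e by auto
    then obtain X where "(b, X) \<in> v" "(c, X) \<in> e" using product_at[OF sS v(1) e(1) _ c] by metis
    then have "\<exists>X. \<exists>v\<in>S. \<exists>e\<in>S. (a, x) \<in> v \<and> (b, X) \<in> v \<and> (b, x) \<in> e \<and> (c, X) \<in> e"
      using v e by auto
    then show ?thesis unfolding f_def by (rule someI_ex)
  qed
  have "automorphism f"
  proof (rule automorphismI)
    fix r x y assume r: "r \<in> S" "(x, y) \<in> r"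
    obtain v e where x: "v \<in> S" "e \<in> S" "(a, x) \<in> v" "(b, f x) \<in> v" "(b, x) \<in> e" "(c, f x) \<in> e"
      using f[of x] basic_dom[OF r] by auto
    obtain w g where y: "w \<in> S" "g \<in> S" "(a, y) \<in> w" "(b, f y) \<in> w" "(b, y) \<in> g" "(c, f y) \<in> g"
      using f[of y] basic_dom[OF r] by auto
    show "(f x, f y) \<in> r"
      using base_rigid[OF assms(1,2) x(1) y(1) x(2) y(2) r(1) assms(3) x(3) y(3) x(5) y(5) r(2) c
          x(4) y(4) x(6) y(6)] .
  qed
  moreover have "f a = b"
  proof -
    obtain v where v: "v \<in> S" "(a, a) \<in> v" "(b, f a) \<in> v" using f ab by metis
    have "(a, a) \<in> Id_on \<Omega>" using ab(1) by (rule Id_onI)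
    then have "v = Id_on \<Omega>" by (rule basic_eq[OF v(1) diagonal_basic v(2)])
    then show ?thesis using v by auto
  qed
  ultimately show ?thesis using that by simp
qed

subsection \<open>Transitivity\<close>

lemma transitive:
  assumes "a \<in> \<Omega>" "b \<in> \<Omega>"
  obtains f where "automorphism f" "f a = b"
proof -
  obtain s where s: "s \<in> S" "(a, b) \<in> s" using basic_ex assms by metis
  consider "thin s" | v where "nonthin s" "nonthin v" "s\<inverse> O v \<in> S"
    | "nonthin s" "\<And>v. nonthin v \<Longrightarrow> s\<inverse> O v \<notin> S"
    using thin_or_nonthin[OF s(1)] by metis
  then show ?thesis
  proof cases
    case 1
    then show ?thesis using translation_automorphism s(2) that by metis
  next
    case 2
    then show ?thesis using transitive_if_single_product assms that by metis
  next
    case 3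
    then show ?thesis using transitive_nonthin[OF 3 s(2)] that by metis
  qed
qed

text \<open>Transitivity moves \<open>x\<close> to \<open>x'\<close>; a swap fixing
  \<open>x'\<close> then corrects the second point within its
  \<open>u\<close>-neighbourhood.\<close>

lemma transitive_on_basic:
  assumes "u \<in> S" "(x, y) \<in> u" "(x', y') \<in> u"
  obtains f where "automorphism f" "f x = x'" "f y = y'"
proof -
  obtain g where g: "automorphism g" "g x = x'" using transitive basic_dom assms by metis
  have "(x', g y) \<in> u" using automorphismD[OF g(1) assms(1,2)] g(2) by simp
  then obtain h where h: "automorphism h" "h x' = x'" "h (g y) = y'"
    using swap_automorphism[OF assms(1) _ assms(3)] by metis
  have "automorphism (h \<circ> g)" using g h unfolding automorphism_def by simp
  then show ?thesis using that[of "h \<circ> g"] g h by simp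
qed

section \<open>The automorphism group and its orbits on pairs\<close>

lemma automorphism_bij:
  assumes "automorphism f"
  shows "bij_betw f \<Omega> \<Omega>"
proof -
  have im: "f x \<in> \<Omega>" if "x \<in> \<Omega>" for x
    using automorphismD[OF assms diagonal_basic, of x x] that by auto
  have "inj_on f \<Omega>"
  proof (rule inj_onI)
    fix x y assume xy: "x \<in> \<Omega>" "y \<in> \<Omega>" "f x = f y"
    obtain u where u: "u \<in> S" "(x, y) \<in> u" using basic_ex xy by metis
    have "(f x, f x) \<in> u" using automorphismD[OF assms u] xy by simp
    moreover have "(f x, f x) \<in> Id_on \<Omega>" using im[OF xy(1)] by (rule Id_onI)
    ultimately have "u = Id_on \<Omega>" by (rule basic_eq[OF u(1) diagonal_basic])
    then show "x = y" using u by auto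
  qed
  moreover from this have "f ` \<Omega> = \<Omega>" using endo_inj_surj[OF finite_points] im by auto
  ultimately show ?thesis unfolding bij_betw_def by simp
qed

lemma automorphism_restrict: "automorphism f \<Longrightarrow> automorphism (restrict f \<Omega>)"
  unfolding automorphism_def using basic_dom by fastforce

lemma automorphism_inverse:
  assumes "automorphism f"
  shows "automorphism (inv_into \<Omega> f)"
proof (rule automorphismI)
  fix u x y assume u: "u \<in> S" "(x, y) \<in> u"
  have im: "f ` \<Omega> = \<Omega>" using automorphism_bij[OF assms] unfolding bij_betw_def by simp
  have xy: "x \<in> f ` \<Omega>" "y \<in> f ` \<Omega>" using basic_dom[OF u] im by auto
  obtain v where v: "v \<in> S" "(inv_into \<Omega> f x, inv_into \<Omega> f y) \<in> v"
    using basic_ex inv_into_into[OF xy(1)] inv_into_into[OF xy(2)] by metis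
  have "(x, y) \<in> v" using automorphismD[OF assms v] f_inv_into_f xy by metis
  then have "u = v" by (rule basic_eq[OF u(1) v(1) u(2)])
  then show "(inv_into \<Omega> f x, inv_into \<Omega> f y) \<in> u" using v by simp
qed

definition automorphism_group :: "('a \<Rightarrow> 'a) set" where
  "automorphism_group = {f \<in> Bij \<Omega>. automorphism f}"

lemma automorphism_group_subgroup: "subgroup automorphism_group (BijGroup \<Omega>)"
proof (rule group.subgroupI[OF group_BijGroup])
  show "automorphism_group \<subseteq> carrier (BijGroup \<Omega>)"
    unfolding automorphism_group_def BijGroup_def by auto
  have "automorphism (restrict id \<Omega>)"
    by (rule automorphism_restrict) (simp add: automorphism_def)
  then have "restrict id \<Omega> \<in> automorphism_group"
    unfolding automorphism_group_def using id_Bij[of \<Omega>] by (simp add: id_def)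
  then show "automorphism_group \<noteq> {}" by auto
next
  fix f assume f: "f \<in> automorphism_group"
  then have "inv\<^bsub>BijGroup \<Omega>\<^esub> f = restrict (inv_into \<Omega> f) \<Omega>"
    unfolding automorphism_group_def by (simp add: inv_BijGroup)
  then show "inv\<^bsub>BijGroup \<Omega>\<^esub> f \<in> automorphism_group"
    using f automorphism_restrict[OF automorphism_inverse] restrict_inv_into_Bij
    unfolding automorphism_group_def by auto
next
  fix f g assume fg: "f \<in> automorphism_group" "g \<in> automorphism_group"
  then have "automorphism (compose \<Omega> f g)"
    using automorphism_restrict[of "f \<circ> g"]
    unfolding automorphism_group_def automorphism_def compose_def by (simp add: comp_def)
  then show "f \<otimes>\<^bsub>BijGroup \<Omega>\<^esub> g \<in> automorphism_group"
    using fg compose_Bij unfolding automorphism_group_def BijGroup_def by auto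
qed

lemma orbit_of_pair:
  assumes "u \<in> S" "(x, y) \<in> u"
  shows "orbit (BijGroup \<Omega>\<lparr>carrier := automorphism_group\<rparr>) (pair_action \<Omega>) (x, y) = u"
proof -
  have xy: "x \<in> \<Omega>" "y \<in> \<Omega>" using basic_dom[OF assms] by auto
  have orb: "orbit (BijGroup \<Omega>\<lparr>carrier := automorphism_group\<rparr>) (pair_action \<Omega>) (x, y) =
      (\<lambda>g. (g x, g y)) ` automorphism_group"
    using xy unfolding orbit_def pair_action_def by auto
  show ?thesis unfolding orb
  proof (rule subset_antisym)
    show "(\<lambda>g. (g x, g y)) ` automorphism_group \<subseteq> u"
      using automorphismD assms unfolding automorphism_group_def by auto
    show "u \<subseteq> (\<lambda>g. (g x, g y)) ` automorphism_group"
    proof (rule subrelI)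
      fix x' y' assume "(x', y') \<in> u"
      then obtain f where f: "automorphism f" "f x = x'" "f y = y'"
        using transitive_on_basic assms by metis
      have "restrict f \<Omega> \<in> automorphism_group"
        using automorphism_restrict[OF f(1)] automorphism_bij[OF f(1)]
        unfolding automorphism_group_def Bij_def by simp
      then show "(x', y') \<in> (\<lambda>g. (g x, g y)) ` automorphism_group"
        by (rule rev_image_eqI) (use f xy in simp)
    qed
  qed
qed

lemma schurian: "schurian \<Omega> S"
proof -
  let ?orb = "orbit (BijGroup \<Omega>\<lparr>carrier := automorphism_group\<rparr>) (pair_action \<Omega>)"
  have "S = {?orb p |p. p \<in> \<Omega> \<times> \<Omega>}"
  proof (intro subset_antisym subsetI)
    fix u assume u: "u \<in> S"
    then obtain x y where "(x, y) \<in> u" using basic_nonempty by metis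
    then have "(x, y) \<in> \<Omega> \<times> \<Omega>" "u = ?orb (x, y)" using basic_dom orbit_of_pair u by auto
    then show "u \<in> {?orb p |p. p \<in> \<Omega> \<times> \<Omega>}" by blast
  next
    fix u assume "u \<in> {?orb p |p. p \<in> \<Omega> \<times> \<Omega>}"
    then obtain x y where xy: "x \<in> \<Omega>" "y \<in> \<Omega>" "u = ?orb (x, y)" by auto
    then obtain v where "v \<in> S" "(x, y) \<in> v" using basic_ex by metis
    then show "u \<in> S" using orbit_of_pair xy(3) by simp
  qed
  then show ?thesis
    unfolding schurian_def orbits_def using automorphism_group_subgroup by auto
qed

end

theorem theorem1p3:
  fixes \<Omega> :: "'a set" and S :: "('a \<times> 'a) set set"
  assumes "scheme \<Omega> S"
    and "commutative_configuration S"
    and "quasi_thin \<Omega> S"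
  shows "schurian \<Omega> S"
proof -
  have "commutative_quasi_thin_scheme \<Omega> S"
    unfolding commutative_quasi_thin_scheme_def commutative_quasi_thin_scheme_axioms_def
    using assms by simp
  then show ?thesis by (rule commutative_quasi_thin_scheme.schurian)
qed

end
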